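(* Let the controlled Markov process $(X_n)_{n=0}^N$, the training distribution $\mu$, the transition density $r\le\bar R^2$, the bounded measurable rewards $f,g$, the value function $V$ with bound $\Gamma$, the basis functions $\phi_1,\dots,\phi_K$ (with Gram matrix $\mathcal{A}_K$), and the regress-later value iteration estimate $\hat V$ built from $M$ training points per time step be as in the context, with $f(n,x,\cdot)$ and $\hat\phi^n_k(x,\cdot)$ upper semicontinuous in $u$. Then for all $n=0,1,\dots,N$ \[ \Big\|\hat V(n,\tilde X)-V(n,\tilde X)\Big\|_{L^2_{e,N-n}}\le \bar R\,\frac{\bar R^{N-n}-1}{\bar R-1}\Big(\epsilon_K+\frac{\sqrt K}{\sqrt M}\,\Gamma\,\|\mathcal{A}_K^{-1/2}\|_2\max_{k=1,\dots,K}\|\phi_k\|_{L^2_\mu}\Big), \] where $\epsilon_K=\max_{n=1,\dots,N}\big\|\Pi_K V(n,\cdot)-V(n,\cdot)\big\|_{L^2_\mu}$.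
   Context: Controlled process. $\mathcal{D}\subseteq\mathbb{R}^d$ is the (Borel) state space, $\mathcal{D}^U\subset\mathbb{R}^q$ is a compact set of control values, $N,M,K\ge 1$ are integers. The process is $X_{n+1}=\varphi(n,X_n,\xi_n,u_n)$, $n=0,\dots,N-1$, with $\varphi$ Borel measurable, $(\xi_n)$ i.i.d. uniform on $[0,1]$, and feedback controls $u_n=u_n(X_n)\in\mathcal{D}^U$ (the set of such controls is $\mathcal{U}$). Density. $\mu$ is a probability measure on $\mathcal{D}$ and $X$ has a (jointly measurable) transition density: $\mathbb{P}(X_{n+1}\in A\mid X_n=x,u_n=u)=\int_A r(n,x,u;y)\,\mu(dy)$, with $r(n,x,u;y)\le\bar R^2$ for all $n,x,u,y$, where $\bar R>0$ is a constant (necessarily $\bar R\ge1$). Rewards and value function. $f(n,x,u)$ and $g(x)$ are measurable and bounded. $V(n,x)=\sup_{u\in\mathcal{U}}\mathbb{E}\big[\sum_{s=n}^{N-1}f(s,X_s,u_s)+g(X_N)\mid X_n=x\big]$; equivalently $V(N,x)=g(x)$ and $V(n,x)=\max_{u\in\mathcal{D}^U}\{f(n,x,u)+\mathbb{E}[V(n+1,X_{n+1})\mid X_n=x,u_n=u]\}$. $\Gamma$ is a constant with $|V(n,x)|\le\Gamma$ for all $n=0,\dots,N$, $x\in\mathcal{D}$. Functions of $x$ obtained by optimising over $u$ are understood to be measurable. Basis functions. $L^2_\mu=L^2(\mathcal{D},\mu)$. $\phi_1,\dots,\phi_K\in L^2_\mu$ are linearly independent, $\pmb\phi=(\phi_1,\dots,\phi_K)^T$,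 $\mathcal{A}_K=\int\pmb\phi\pmb\phi^T d\mu$ (a $K\times K$ matrix), $\|\cdot\|_2$ of a matrix is the operator norm induced by the Euclidean norm. $\Pi_K$ is the orthogonal projection in $L^2_\mu$ onto $\mathrm{lin}(\phi_1,\dots,\phi_K)$. $\hat\phi_k^n(x,u)=\mathbb{E}[\phi_k(X_{n+1})\mid X_n=x,u_n=u]=\int_{\mathcal{D}}\phi_k(y)r(n,x,u;y)\mu(dy)$. Value iteration. Let $\tilde X^m_s$, $m=1,\dots,M$, $s=1,\dots,N$, be i.i.d. with law $\mu$ (training points). Put $\hat V(N,x)=g(x)$, and for $n=N-1,\dots,0$: $\hat{\pmb\alpha}^{n+1}=\mathcal{A}_K^{-1}\frac1M\sum_{m=1}^M\hat V(n+1,\tilde X^m_{n+1})\pmb\phi(\tilde X^m_{n+1})$, $\hat V(n,x)=\max\big\{-\Gamma,\min\{\Gamma,\ \sup_{u\in\mathcal{D}^U}\{f(n,x,u)+\sum_{k=1}^K\hat\alpha^{n+1}_k\hat\phi^n_k(x,u)\}\}\big\}$. Thus $\hat V(n,\cdot)$ depends on the training points $\tilde X^m_s$ with $s=n+1,\dots,N$. Norm. $L^2_{e,j}=L^2(\mathcal{D}^{Mj}\times\mathcal{D},\mu^{Mj}\otimes\mu)$, where the first $Mj$ coordinates are the training points $\tilde X^m_s$, $m=1,\dots,M$, $s=N-j+1,\dots,N$, and the last coordinate is an independent $\tilde X\sim\mu$. So $\|\hat V(n,\tilde X)-V(n,\tilde X)\|_{L^2_{e,N-n}}^2$ is the expectation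 of $|\hat V(n,\tilde X)-V(n,\tilde X)|^2$ over the training points and $\tilde X$. When $\bar R=1$, $\frac{\bar R^{j}-1}{\bar R-1}$ is read as $\sum_{s=0}^{j-1}\bar R^s=j$. *)

theory Defs
  imports "HOL-Probability.Probability"
begin

definition feedback_controls ::
  "nat \<Rightarrow> (real^'d) set \<Rightarrow> (real^'q) set \<Rightarrow> (nat \<Rightarrow> real^'d \<Rightarrow> real^'q) set" where
  "feedback_controls N D DU =
     {w. \<forall>s<N. w s \<in> restrict_space borel D \<rightarrow>\<^sub>M restrict_space borel DU}"

text \<open>\<open>path dyn w n x z j\<close> is the state at time \<open>n + j\<close> of the process that starts in \<open>x\<close> at
  time \<open>n\<close>, is controlled by \<open>w\<close> and driven by the noise values \<open>z n, z (n+1), \<dots>\<close>.\<close>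

primrec path ::
  "(nat \<Rightarrow> 'x \<Rightarrow> real \<Rightarrow> 'u \<Rightarrow> 'x) \<Rightarrow> (nat \<Rightarrow> 'x \<Rightarrow> 'u) \<Rightarrow> nat \<Rightarrow> 'x \<Rightarrow> (nat \<Rightarrow> real)
    \<Rightarrow> nat \<Rightarrow> 'x" where
  "path dyn w n x z 0 = x"
| "path dyn w n x z (Suc j) =
     (let y = path dyn w n x z j in dyn (n + j) y (z (n + j)) (w (n + j) y))"

text \<open>Since the noise after time \<open>n\<close> is independent of the state at time \<open>n\<close>, conditioning on
  that state being \<open>x\<close> means starting the dynamics in \<open>x\<close> at time \<open>n\<close>.\<close>

definition expected_reward ::
  "'w measure \<Rightarrow> (nat \<Rightarrow> 'w \<Rightarrow> real) \<Rightarrow> nat \<Rightarrow> (nat \<Rightarrow> 'x \<Rightarrow> real \<Rightarrow> 'u \<Rightarrow> 'x)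
    \<Rightarrow> (nat \<Rightarrow> 'x \<Rightarrow> 'u \<Rightarrow> real) \<Rightarrow> ('x \<Rightarrow> real) \<Rightarrow> (nat \<Rightarrow> 'x \<Rightarrow> 'u) \<Rightarrow> nat \<Rightarrow> 'x \<Rightarrow> real" where
  "expected_reward P \<xi> N dyn f g w n x =
     (\<integral>\<omega>. (let X = (\<lambda>s. path dyn w n x (\<lambda>i. \<xi> i \<omega>) (s - n))
           in (\<Sum>s\<in>{n..<N}. f s (X s) (w s (X s))) + g (X N)) \<partial>P)"

definition value_fn ::
  "'w measure \<Rightarrow> (nat \<Rightarrow> 'w \<Rightarrow> real) \<Rightarrow> nat \<Rightarrow> (real^'d) set \<Rightarrow> (real^'q) set
    \<Rightarrow> (nat \<Rightarrow> real^'d \<Rightarrow> real \<Rightarrow> real^'q \<Rightarrow> real^'d)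
    \<Rightarrow> (nat \<Rightarrow> real^'d \<Rightarrow> real^'q \<Rightarrow> real) \<Rightarrow> (real^'d \<Rightarrow> real) \<Rightarrow> nat \<Rightarrow> real^'d \<Rightarrow> real" where
  "value_fn P \<xi> N D DU dyn f g n x =
     (SUP w\<in>feedback_controls N D DU. expected_reward P \<xi> N dyn f g w n x)"

text \<open>In the same way this is \<open>E[h(X\<^sub>n\<^sub>+\<^sub>1) | X\<^sub>n = x, u\<^sub>n = u]\<close>.\<close>

definition next_expectation ::
  "'w measure \<Rightarrow> (nat \<Rightarrow> 'w \<Rightarrow> real) \<Rightarrow> (nat \<Rightarrow> 'x \<Rightarrow> real \<Rightarrow> 'u \<Rightarrow> 'x)
    \<Rightarrow> ('x \<Rightarrow> real) \<Rightarrow> nat \<Rightarrow> 'x \<Rightarrow> 'u \<Rightarrow> real" where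
  "next_expectation P \<xi> dyn h n x u = (\<integral>\<omega>. h (dyn n x (\<xi> n \<omega>) u) \<partial>P)"

definition upper_semicontinuous_on :: "'a::topological_space set \<Rightarrow> ('a \<Rightarrow> real) \<Rightarrow> bool" where
  "upper_semicontinuous_on S h \<longleftrightarrow> (\<forall>t. openin (top_of_set S) {u \<in> S. h u < t})"

text \<open>Only meaningful for square-integrable functions: the Bochner integral of a
  non-integrable function is \<open>0\<close>.\<close>

definition l2_norm :: "'a measure \<Rightarrow> ('a \<Rightarrow> real) \<Rightarrow> real" where
  "l2_norm M h = sqrt (\<integral>x. (h x)\<^sup>2 \<partial>M)"

definition lin :: "('k::finite \<Rightarrow> 'x \<Rightarrow> real) \<Rightarrow> ('x \<Rightarrow> real) set" where
  "lin \<phi> = {h. \<exists>c::real^'k. h = (\<lambda>x. \<Sum>k\<in>UNIV. c$k * \<phi> k x)}"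

definition l2_independent :: "'x measure \<Rightarrow> ('k::finite \<Rightarrow> 'x \<Rightarrow> real) \<Rightarrow> bool" where
  "l2_independent \<mu> \<phi> \<longleftrightarrow>
     (\<forall>c::real^'k. (AE x in \<mu>. (\<Sum>k\<in>UNIV. c$k * \<phi> k x) = 0) \<longrightarrow> c = 0)"

text \<open>Orthogonal projection onto \<open>lin \<phi>\<close>. For square-integrable \<open>v\<close> and linearly independent \<open>\<phi>\<close>
  there is exactly one such \<open>h\<close>, as a function and not only up to null sets, because its
  coefficients are unique.\<close>

definition l2_proj :: "'x measure \<Rightarrow> ('k::finite \<Rightarrow> 'x \<Rightarrow> real) \<Rightarrow> ('x \<Rightarrow> real) \<Rightarrow> 'x \<Rightarrow> real" where
  "l2_proj \<mu> \<phi> v =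
     (THE h. h \<in> lin \<phi> \<and> (\<forall>b\<in>lin \<phi>. (\<integral>x. (v x - h x) * b x \<partial>\<mu>) = 0))"

definition gram :: "'x measure \<Rightarrow> ('k::finite \<Rightarrow> 'x \<Rightarrow> real) \<Rightarrow> real^'k^'k" where
  "gram \<mu> \<phi> = (\<chi> i j. \<integral>x. \<phi> i x * \<phi> j x \<partial>\<mu>)"

definition pos_semidef :: "real^'k^'k \<Rightarrow> bool" where
  "pos_semidef B \<longleftrightarrow> transpose B = B \<and> (\<forall>v. 0 \<le> v \<bullet> (B *v v))"

text \<open>The square root of a symmetric positive semidefinite matrix; its inverse is
  \<open>A\<close> to the power \<open>-1/2\<close>.\<close>

definition matrix_sqrt :: "real^'k^'k \<Rightarrow> real^'k^'k" where
  "matrix_sqrt A = (THE B. pos_semidef B \<and> B ** B = A)"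

definition regression_coeff ::
  "'x measure \<Rightarrow> ('k::finite \<Rightarrow> 'x \<Rightarrow> real) \<Rightarrow> nat \<Rightarrow> ('x \<Rightarrow> real) \<Rightarrow> (nat \<Rightarrow> 'x) \<Rightarrow> real^'k" where
  "regression_coeff \<mu> \<phi> M v p =
     matrix_inv (gram \<mu> \<phi>) *v ((1 / real M) *\<^sub>R (\<Sum>m=1..M. v (p m) *\<^sub>R (\<chi> k. \<phi> k (p m))))"

definition control_sup ::
  "'u set \<Rightarrow> (nat \<Rightarrow> 'x \<Rightarrow> 'u \<Rightarrow> real) \<Rightarrow> (nat \<Rightarrow> 'k \<Rightarrow> 'x \<Rightarrow> 'u \<Rightarrow> real) \<Rightarrow> nat \<Rightarrow> real^'k::finite
    \<Rightarrow> 'x \<Rightarrow> real" where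
  "control_sup DU f \<phi>h n \<alpha> x = (SUP u\<in>DU. f n x u + (\<Sum>k\<in>UNIV. \<alpha>$k * \<phi>h n k x u))"

text \<open>\<open>vhat_back \<dots> j\<close> is the estimate at time \<open>N - j\<close>. The argument \<open>\<phi>h\<close> stands for the conditional
  expectations of the basis functions, and \<open>p (m, s)\<close> is the \<open>m\<close>-th training point for time \<open>s\<close>.\<close>

primrec vhat_back ::
  "nat \<Rightarrow> nat \<Rightarrow> 'x measure \<Rightarrow> 'u set \<Rightarrow> (nat \<Rightarrow> 'x \<Rightarrow> 'u \<Rightarrow> real) \<Rightarrow> ('x \<Rightarrow> real) \<Rightarrow> real
    \<Rightarrow> ('k::finite \<Rightarrow> 'x \<Rightarrow> real) \<Rightarrow> (nat \<Rightarrow> 'k \<Rightarrow> 'x \<Rightarrow> 'u \<Rightarrow> real)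
    \<Rightarrow> nat \<Rightarrow> (nat \<times> nat \<Rightarrow> 'x) \<Rightarrow> 'x \<Rightarrow> real" where
  "vhat_back N M \<mu> DU f g \<Gamma> \<phi> \<phi>h 0 = (\<lambda>p x. g x)"
| "vhat_back N M \<mu> DU f g \<Gamma> \<phi> \<phi>h (Suc j) = (\<lambda>p x.
     let n = N - Suc j;
         \<alpha> = regression_coeff \<mu> \<phi> M (vhat_back N M \<mu> DU f g \<Gamma> \<phi> \<phi>h j p) (\<lambda>m. p (m, Suc n))
     in max (- \<Gamma>) (min \<Gamma> (control_sup DU f \<phi>h n \<alpha> x)))"

definition vhat ::
  "nat \<Rightarrow> nat \<Rightarrow> 'x measure \<Rightarrow> 'u set \<Rightarrow> (nat \<Rightarrow> 'x \<Rightarrow> 'u \<Rightarrow> real) \<Rightarrow> ('x \<Rightarrow> real) \<Rightarrow> real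
    \<Rightarrow> ('k::finite \<Rightarrow> 'x \<Rightarrow> real) \<Rightarrow> (nat \<Rightarrow> 'k \<Rightarrow> 'x \<Rightarrow> 'u \<Rightarrow> real)
    \<Rightarrow> nat \<Rightarrow> (nat \<times> nat \<Rightarrow> 'x) \<Rightarrow> 'x \<Rightarrow> real" where
  "vhat N M \<mu> DU f g \<Gamma> \<phi> \<phi>h n = vhat_back N M \<mu> DU f g \<Gamma> \<phi> \<phi>h (N - n)"

text \<open>Joint law of the training points of the last \<open>j\<close> time steps and one further independent point,
  i.e. \<open>\<mu>\<close> to the power \<open>M * j\<close>, times \<open>\<mu>\<close>.\<close>

definition training_law :: "nat \<Rightarrow> nat \<Rightarrow> 'x measure \<Rightarrow> nat \<Rightarrow> ((nat \<times> nat \<Rightarrow> 'x) \<times> 'x) measure" where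
  "training_law N M \<mu> j = (\<Pi>\<^sub>M i\<in>{1..M} \<times> {N - j + 1..N}. \<mu>) \<Otimes>\<^sub>M \<mu>"

end

theory Submission
  imports Defs
begin

text \<open>The value function satisfies the Bellman equation: a measurable selector gives an
  \<open>e\<close>-optimal policy for almost every state, which suffices since the next state has a density.
  As clipping and the supremum over the controls are \<open>1\<close>-Lipschitz, Jensen's inequality and
  \<open>r \<le> R\<^sup>2\<close> bound the error at time \<open>n\<close>, given the training points, by \<open>R\<close> times
  the \<open>L\<^sup>2(\<mu>)\<close> error of the regressed continuation value. The latter is at most the sum of the
  projection error of the true value function, the error at time \<open>n + 1\<close> (an orthogonal projection is a
  contraction) and the sampling error of the coefficients, which has
  \<open>L\<^sup>2\<close> norm at most \<open>\<surd>K / \<surd>M\<close> times \<open>\<Gamma>\<close>,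
  the norm of \<open>A\<close> to the power \<open>-1/2\<close> and the largest norm of a basis function. Iterating
  \<open>e\<^sub>n \<le> R (c + e\<^sub>n\<^sub>+\<^sub>1)\<close> from \<open>e\<^sub>N = 0\<close> gives a geometric sum.\<close>

section \<open>Square roots of positive definite matrices\<close>

text \<open>Two definitions shape the proof. \<open>matrix_sqrt\<close> is a definite description,
  so existence and uniqueness of the root must be settled before \<open>A\<close> to the power -1/2
  can enter an estimate. That power appears, rather than the inverse of \<open>A\<close>, because
  the function with coefficient vector (inverse of \<open>A\<close>) applied to \<open>d\<close> has
  as its L2 norm the Euclidean norm of \<open>A\<close> to the power -1/2 applied to
  \<open>d\<close>. \<open>value_fn\<close> is a pointwise supremum over whole policies, so the
  Bellman equation is a theorem and needs one policy that is nearly optimal from almost all next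
  states at once.

  The estimate is random. Measurability of the optimised expression is given for each fixed
  coefficient vector, whereas the regression inserts coefficients that depend on the training
  points; Lipschitz dependence on the coefficients supplies the joint measurability that Fubini's
  theorem needs.

  The constants: the factor R is the root of the density bound, as the square is taken inside the
  expectation; the root of K comes from adding the variances of K sample moments, the root of M from
  averaging, and \<Gamma> from the truncation, which bounds the sampled values for every choice of
  training points.\<close>

definition pos_definite :: "real^'k^'k \<Rightarrow> bool" where
  "pos_definite A \<longleftrightarrow> transpose A = A \<and> (\<exists>m>0. \<forall>v. m * (v \<bullet> v) \<le> v \<bullet> (A *v v))"

lemma symmetric_inner:
  fixes A :: "real^'k^'k"
  assumes "transpose A = A"
  shows "(A *v v) \<bullet> w = v \<bullet> (A *v w)"
  using assms by (metis dot_lmul_matrix transpose_matrix_vector)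

lemma symmetricI:
  fixes A :: "real^'k^'k"
  assumes "\<And>v w. (A *v v) \<bullet> w = v \<bullet> (A *v w)"
  shows "transpose A = A"
proof -
  have "v \<bullet> (transpose A *v w) = v \<bullet> (A *v w)" for v w
    using assms[of v w] by (metis dot_lmul_matrix inner_commute transpose_matrix_vector)
  then show ?thesis
    by (metis matrix_eq vector_eq_rdot inner_commute)
qed

lemma pos_definite_invertible:
  fixes A :: "real^'k^'k"
  assumes "pos_definite A"
  shows "invertible A"
proof -
  obtain m where m: "m > 0" "\<And>v. m * (v \<bullet> v) \<le> v \<bullet> (A *v v)"
    using assms unfolding pos_definite_def by auto
  have "v = 0" if "A *v v = 0" for v
    using m(1) m(2)[of v] that by (metis inner_gt_zero_iff inner_zero_right mult_pos_pos not_le)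
  then have "\<exists>B. B ** A = mat 1"
    by (simp add: matrix_left_invertible_ker)
  then show ?thesis
    using invertible_left_inverse by blast
qed

lemma matrix_inv_mult:
  fixes A :: "real^'k^'k"
  assumes "invertible A"
  shows "matrix_inv A *v (A *v v) = v" "A *v (matrix_inv A *v v) = v"
proof -
  have "A ** matrix_inv A = mat 1 \<and> matrix_inv A ** A = mat 1"
    using assms unfolding matrix_inv_def invertible_def by (rule someI_ex)
  then show "matrix_inv A *v (A *v v) = v" "A *v (matrix_inv A *v v) = v"
    by (simp_all add: matrix_vector_mul_assoc)
qed

text \<open>With a lower bound m for the quadratic form and an operator norm of at most L, expanding
  the square bounds |v - A v / t|^2 by (1 - 2 m / t + L^2 / t^2) |v|^2. The choice t = L^2 / m
  minimises the factor and leaves 1 - (m / L)^2.\<close>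

lemma pos_definite_contraction:
  fixes A :: "real^'k^'k"
  assumes "pos_definite A"
  obtains t q where "t > 0" "0 \<le> q" "q < 1"
    "\<And>v. norm (v - (1 / t) *\<^sub>R (A *v v)) \<le> q * norm v"
proof -
  obtain m where m: "m > 0" "\<And>v. m * (v \<bullet> v) \<le> v \<bullet> (A *v v)"
    using assms unfolding pos_definite_def by auto
  \<comment> \<open>The maximum with \<open>m\<close> makes \<open>0 < L\<close> and
    \<open>m \<le> L\<close> immediate, so that \<open>q\<close> below is the root of a number in
    [0, 1).\<close>
  define L where "L = max m (onorm ((*v) A))"
  have L: "norm (A *v v) \<le> L * norm v" for v
    using onorm[OF matrix_vector_mul_bounded_linear, of A v]
      mult_right_mono[of "onorm ((*v) A)" L "norm v"]
    by (simp add: L_def)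
  have "L > 0" "m \<le> L"
    using m(1) by (auto simp: L_def)
  define t where "t = L\<^sup>2 / m"
  define q where "q = sqrt (1 - (m / L)\<^sup>2)"
  have "t > 0"
    using \<open>L > 0\<close> m by (simp add: t_def)
  have mL: "0 < (m / L)\<^sup>2" "(m / L)\<^sup>2 \<le> 1"
    using \<open>L > 0\<close> \<open>m \<le> L\<close> m(1) by (auto simp: power_le_one)
  have "norm (v - (1 / t) *\<^sub>R (A *v v)) \<le> q * norm v" for v
  proof (rule power2_le_imp_le)
    have L2: "(A *v v) \<bullet> (A *v v) \<le> L\<^sup>2 * (v \<bullet> v)"
      using L[of v] power_mono[OF L[of v], of 2]
      by (simp add: power_mult_distrib power2_norm_eq_inner)
    have "(norm (v - (1 / t) *\<^sub>R (A *v v)))\<^sup>2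
        = v \<bullet> v - (2 / t) * (v \<bullet> (A *v v)) + (1 / t)\<^sup>2 * ((A *v v) \<bullet> (A *v v))"
      unfolding power2_norm_eq_inner
      by (simp add: inner_diff_left inner_diff_right inner_commute power2_eq_square)
    also have "\<dots> \<le> v \<bullet> v - (2 / t) * (m * (v \<bullet> v)) + (1 / t)\<^sup>2 * (L\<^sup>2 * (v \<bullet> v))"
      using m(2)[of v] L2 \<open>t > 0\<close>
      by (intro add_mono diff_mono mult_left_mono) auto
    also have "\<dots> = (1 - (m / L)\<^sup>2) * (v \<bullet> v)"
      using \<open>L > 0\<close> m(1) by (simp add: t_def field_simps power2_eq_square)
    also have "\<dots> = (q * norm v)\<^sup>2"
      using mL by (simp add: q_def power_mult_distrib power2_norm_eq_inner)
    finally show "(norm (v - (1 / t) *\<^sub>R (A *v v)))\<^sup>2 \<le> (q * norm v)\<^sup>2" .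
  qed (use mL in \<open>simp add: q_def\<close>)
  moreover have "0 \<le> q" "q < 1"
    using mL by (simp_all add: q_def)
  ultimately show ?thesis
    using that \<open>t > 0\<close> by blast
qed

text \<open>For \<open>X = I - A / t\<close> of norm less than \<open>1\<close>, the map \<open>Y \<mapsto> (X + Y\<^sup>2) / 2\<close> is a contraction,
  and a fixed point \<open>Y\<close> satisfies \<open>(I - Y)\<^sup>2 = I - X = A / t\<close>.\<close>

lemma pos_definite_sqrt_exists:
  fixes A :: "real^'k^'k"
  assumes "pos_definite A"
  shows "\<exists>B. pos_definite B \<and> B ** B = A"
proof -
  obtain t q where t: "t > 0" and q: "0 \<le> q" "q < 1"
    and X_bound: "\<And>v. norm (v - (1 / t) *\<^sub>R (A *v v)) \<le> q * norm v"
    using pos_definite_contraction[OF assms] by blast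
  have A_sym: "(A *v v) \<bullet> w = v \<bullet> (A *v w)" for v w
    using assms by (intro symmetric_inner) (simp add: pos_definite_def)
  \<comment> \<open>The fixed point is sought among bounded linear maps, whose norm is the operator
    norm that \<open>X_bound\<close> controls; matrices carry the Euclidean norm of their
    entries.\<close>
  define X where "X = Blinfun (\<lambda>v::real^'k. v - (1 / t) *\<^sub>R (A *v v))"
  have "bounded_linear (\<lambda>v::real^'k. v - (1 / t) *\<^sub>R (A *v v))"
    by (intro bounded_linear_sub bounded_linear_ident bounded_linear_scaleR_right
        bounded_linear_compose[OF bounded_linear_scaleR_right]
        matrix_vector_mul_bounded_linear)
  then have X: "X v = v - (1 / t) *\<^sub>R (A *v v)" for v
    by (simp add: X_def bounded_linear_Blinfun_apply)
  have X_norm: "norm X \<le> q"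
    using X_bound q by (intro norm_blinfun_bound) (auto simp: X)
  have X_sym: "X v \<bullet> w = v \<bullet> X w" for v w
    using A_sym by (simp add: X inner_diff_left inner_diff_right)
  \<comment> \<open>Self-adjointness is part of the domain so that the fixed point inherits it; it
    survives \<open>F\<close> because the square of a self-adjoint map is self-adjoint. The ball is
    preserved since (q + q^2) / 2 \<le> q, and on it squaring has Lipschitz constant 2 q, which
    \<open>F\<close> halves.\<close>
  define S where "S = {Y :: (real^'k) \<Rightarrow>\<^sub>L (real^'k). norm Y \<le> q \<and> (\<forall>v w. blinfun_apply Y v \<bullet> w = v \<bullet> blinfun_apply Y w)}"
  define F where "F Y = (1 / 2) *\<^sub>R (X + (Y o\<^sub>L Y))" for Y
  have "closed S"
    unfolding S_def
    by (intro closed_Collect_conj closed_Collect_all closed_Collect_le closed_Collect_eq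
        continuous_intros)
  note complete = iffD2[OF complete_eq_closed this]
  have "\<exists>!Y\<in>S. F Y = Y"
  proof (rule Banach_fix[OF complete _ q])
    show "S \<noteq> {}"
      using X_norm X_sym by (auto simp: S_def)
    show "F ` S \<subseteq> S"
    proof (clarsimp simp: S_def, intro conjI allI)
      fix Y :: "(real^'k) \<Rightarrow>\<^sub>L (real^'k)" and v w
      assume Y: "norm Y \<le> q" and sym: "\<forall>v w. Y v \<bullet> w = v \<bullet> Y w"
      have "norm (Y o\<^sub>L Y) \<le> q * q"
        using norm_blinfun_compose[of Y Y] mult_mono[OF Y Y] q by simp
      also have "\<dots> \<le> q"
        using q mult_right_le_one_le[of q q] by simp
      finally have "norm (X + (Y o\<^sub>L Y)) \<le> q + q"
        using X_norm by (intro norm_triangle_le) simp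
      then show "norm (F Y) \<le> q"
        by (simp add: F_def)
      show "F Y v \<bullet> w = v \<bullet> F Y w"
        using sym X_sym
        by (simp add: F_def blinfun.bilinear_simps inner_add_left inner_add_right)
    qed
    fix Y Z
    assume Y: "Y \<in> S" and Z: "Z \<in> S"
    have "(Y o\<^sub>L Y) - (Z o\<^sub>L Z) = (Y o\<^sub>L (Y - Z)) + ((Y - Z) o\<^sub>L Z)"
      by (intro blinfun_eqI) (simp add: blinfun.bilinear_simps)
    then have "norm ((Y o\<^sub>L Y) - (Z o\<^sub>L Z)) \<le> norm Y * norm (Y - Z) + norm (Y - Z) * norm Z"
      by (metis add_mono norm_blinfun_compose norm_triangle_le)
    also have "\<dots> \<le> q * norm (Y - Z) + norm (Y - Z) * q"
      using Y Z by (intro add_mono mult_right_mono mult_left_mono) (auto simp: S_def)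
    finally have "norm ((Y o\<^sub>L Y) - (Z o\<^sub>L Z)) \<le> 2 * (q * norm (Y - Z))"
      by simp
    moreover have "F Y - F Z = (1 / 2) *\<^sub>R ((Y o\<^sub>L Y) - (Z o\<^sub>L Z))"
      by (simp add: F_def algebra_simps)
    ultimately show "dist (F Y) (F Z) \<le> q * dist Y Z"
      by (simp add: dist_norm)
  qed
  then obtain Y where "Y \<in> S" and FY: "F Y = Y"
    by blast
  then have Y_norm: "norm Y \<le> q" and Y_sym: "\<And>v w. Y v \<bullet> w = v \<bullet> Y w"
    by (auto simp: S_def)
  have Y_fix: "Y (Y v) = 2 *\<^sub>R Y v - X v" for v
  proof -
    have "Y v = F Y v"
      by (simp add: FY)
    also have "\<dots> = (1 / 2) *\<^sub>R (X v + Y (Y v))"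
      by (simp add: F_def blinfun.bilinear_simps)
    finally have "2 *\<^sub>R Y v = 2 *\<^sub>R ((1 / 2) *\<^sub>R (X v + Y (Y v)))"
      by (rule arg_cong)
    then show ?thesis
      by simp
  qed
  define B where "B = matrix (\<lambda>v. sqrt t *\<^sub>R (v - Y v))"
  have "linear (\<lambda>v. sqrt t *\<^sub>R (v - Y v))"
    by (rule linearI) (simp_all add: blinfun.bilinear_simps algebra_simps)
  then have B: "B *v v = sqrt t *\<^sub>R (v - Y v)" for v
    by (simp add: B_def matrix_works)
  have "transpose B = B"
    by (rule symmetricI) (simp add: B Y_sym inner_diff_left inner_diff_right)
  moreover have "sqrt t * (1 - q) * (v \<bullet> v) \<le> v \<bullet> (B *v v)" for v
  proof -
    have "v \<bullet> Y v \<le> norm v * norm (Y v)"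
      by (rule norm_cauchy_schwarz)
    also have "\<dots> \<le> norm v * (q * norm v)"
      by (intro mult_left_mono order.trans[OF norm_blinfun] mult_right_mono Y_norm) auto
    also have "\<dots> = q * (v \<bullet> v)"
      by (simp add: norm_eq_sqrt_inner)
    finally have "(1 - q) * (v \<bullet> v) \<le> v \<bullet> (v - Y v)"
      by (simp add: inner_diff_right algebra_simps)
    from mult_left_mono[OF this, of "sqrt t"] show ?thesis
      using t by (simp add: B mult.assoc)
  qed
  moreover have "sqrt t * (1 - q) > 0"
    using t q by simp
  ultimately have "pos_definite B"
    unfolding pos_definite_def by blast
  moreover have "(B ** B) *v v = A *v v" for v
  proof -
    have "(B ** B) *v v = t *\<^sub>R (v - Y v - (Y v - Y (Y v)))"
      using t by (simp add: B matrix_vector_mul_assoc[symmetric] blinfun.bilinear_simps algebra_simps)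
    also have "v - Y v - (Y v - Y (Y v)) = v - X v"
      by (simp add: Y_fix scaleR_2)
    also have "t *\<^sub>R (v - X v) = A *v v"
      using t by (simp add: X)
    finally show ?thesis .
  qed
  ultimately show ?thesis
    by (metis matrix_eq)
qed

text \<open>Each summand is a quadratic form evaluated at a column of \<open>D\<close>. For
  semidefinite \<open>B\<close> all of them are nonnegative, so a vanishing trace forces every one
  to vanish.\<close>

lemma trace_symmetric_sandwich:
  fixes D B :: "real^'k^'k"
  assumes "transpose D = D"
  shows "trace (D ** B ** D) = (\<Sum>i\<in>UNIV. (D *v axis i 1) \<bullet> (B *v (D *v axis i 1)))"
proof -
  have "(D ** B ** D) $ i $ i = axis i 1 \<bullet> ((D ** B ** D) *v axis i 1)" for i
    by (simp add: inner_axis' matrix_vector_mult_basis column_def)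
  also have "axis i 1 \<bullet> ((D ** B ** D) *v axis i 1) = (D *v axis i 1) \<bullet> (B *v (D *v axis i 1))" for i
    using symmetric_inner[OF assms] by (simp add: matrix_vector_mul_assoc[symmetric])
  finally show ?thesis
    by (simp add: trace_def)
qed

text \<open>For \<open>D = B - C\<close>, the identity \<open>B D + D C = B\<^sup>2 - C\<^sup>2 = 0\<close> shows that
  \<open>D (B + C) D\<close> has trace \<open>0\<close>.\<close>

lemma matrix_sqrt_unique:
  fixes B C :: "real^'k^'k"
  assumes B: "pos_semidef B" and C: "pos_definite C" and eq: "B ** B = C ** C"
  shows "B = C"
proof -
  define D where "D = B - C"
  have [simp]: "transpose D = D"
    using B C by (simp add: D_def pos_semidef_def pos_definite_def transpose_def vec_eq_iff)
  obtain c where c: "c > 0" "\<And>v. c * (v \<bullet> v) \<le> v \<bullet> (C *v v)"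
    using C unfolding pos_definite_def by auto
  have "B *v (B *v v) = C *v (C *v v)" for v
    by (simp add: matrix_vector_mul_assoc eq)
  then have "(B ** D + D ** C) *v v = 0 *v v" for v
    by (simp add: D_def matrix_vector_mul_assoc[symmetric] algebra_simps)
  then have "B ** D + D ** C = 0"
    by (metis matrix_eq)
  then have "D ** (B ** D + D ** C) = 0"
    by simp
  then have "trace (D ** B ** D) + trace (D ** D ** C) = 0"
    by (metis matrix_add_ldistrib matrix_mul_assoc trace_0 trace_add mat_0)
  moreover have "trace (D ** D ** C) = trace (D ** C ** D)"
    by (metis trace_mul_sym matrix_mul_assoc)
  ultimately have "(\<Sum>i\<in>UNIV. (D *v axis i 1) \<bullet> (B *v (D *v axis i 1)))
      + (\<Sum>i\<in>UNIV. (D *v axis i 1) \<bullet> (C *v (D *v axis i 1))) = 0"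
    by (simp add: trace_symmetric_sandwich)
  moreover have "0 \<le> (\<Sum>i\<in>UNIV. (D *v axis i 1) \<bullet> (B *v (D *v axis i 1)))"
    using B by (intro sum_nonneg) (simp add: pos_semidef_def)
  moreover have C_nonneg: "0 \<le> v \<bullet> (C *v v)" for v
    using c(1) by (intro order.trans[OF _ c(2)[of v]]) simp
  ultimately have "(\<Sum>i\<in>UNIV. (D *v axis i 1) \<bullet> (C *v (D *v axis i 1))) = 0"
    using sum_nonneg[of UNIV "\<lambda>i. (D *v axis i 1) \<bullet> (C *v (D *v axis i 1))"] by fastforce
  then have "(D *v axis i 1) \<bullet> (C *v (D *v axis i 1)) = 0" for i
    using C_nonneg by (subst (asm) sum_nonneg_eq_0_iff) auto
  then have "D *v axis i 1 = 0" for i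
    using c by (metis inner_gt_zero_iff mult_pos_pos not_le)
  then have "D = 0"
    by (simp add: matrix_vector_mult_basis column_def vec_eq_iff)
  then show ?thesis
    by (simp add: D_def)
qed

text \<open>Resolves the definite description. Its competitors are only known to be semidefinite,
  which is why \<open>matrix_sqrt_unique\<close> asks definiteness of one root only.\<close>

lemma matrix_sqrt_pos_definite:
  fixes A :: "real^'k^'k"
  assumes "pos_definite A"
  shows "pos_definite (matrix_sqrt A)" "matrix_sqrt A ** matrix_sqrt A = A"
proof -
  obtain C where C: "pos_definite C" "C ** C = A"
    using pos_definite_sqrt_exists[OF assms] by blast
  then obtain c where c: "c > 0" "\<And>v. c * (v \<bullet> v) \<le> v \<bullet> (C *v v)"
    unfolding pos_definite_def by auto
  have "0 \<le> v \<bullet> (C *v v)" for v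
    using c(1) by (intro order.trans[OF _ c(2)[of v]]) simp
  then have "pos_semidef C"
    using C(1) by (simp add: pos_semidef_def pos_definite_def)
  then have "matrix_sqrt A = C"
    unfolding matrix_sqrt_def using C matrix_sqrt_unique by (intro the_equality) auto
  then show "pos_definite (matrix_sqrt A)" "matrix_sqrt A ** matrix_sqrt A = A"
    using C by auto
qed

text \<open>For B the root of A and A c = d, the form is |B c|^2, and B (B c) = d turns B c into the
  inverse of B applied to d.\<close>

lemma quadratic_form_matrix_inv_le:
  fixes A :: "real^'k^'k"
  assumes "pos_definite A"
  shows "(matrix_inv A *v d) \<bullet> (A *v (matrix_inv A *v d))
    \<le> (onorm ((*v) (matrix_inv (matrix_sqrt A))) * norm d)\<^sup>2"
proof -
  define B where "B = matrix_sqrt A"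
  define c where "c = matrix_inv A *v d"
  have B: "pos_definite B" "B ** B = A"
    using matrix_sqrt_pos_definite[OF assms] by (simp_all add: B_def)
  have "A *v c = d"
    using pos_definite_invertible[OF assms] by (simp add: c_def matrix_inv_mult)
  then have "B *v (B *v c) = d"
    by (simp add: B matrix_vector_mul_assoc)
  then have Bc: "B *v c = matrix_inv B *v d"
    using pos_definite_invertible[OF B(1)] matrix_inv_mult(1) by metis
  have "c \<bullet> (A *v c) = (norm (B *v c))\<^sup>2"
    using B symmetric_inner[of B c "B *v c"]
    by (simp add: power2_norm_eq_inner matrix_vector_mul_assoc pos_definite_def)
  also have "\<dots> \<le> (onorm ((*v) (matrix_inv B)) * norm d)\<^sup>2"
    unfolding Bc by (intro power_mono onorm matrix_vector_mul_bounded_linear) simp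
  finally show ?thesis
    by (simp add: B_def c_def)
qed

section \<open>Square-integrable functions\<close>

lemma l2_norm_nonneg [simp]: "0 \<le> l2_norm M h"
  by (simp add: l2_norm_def)

lemma l2_norm_power2: "(l2_norm M h)\<^sup>2 = (\<integral>x. (h x)\<^sup>2 \<partial>M)"
  by (simp add: l2_norm_def)

lemma l2_norm_le_iff:
  assumes "0 \<le> c"
  shows "l2_norm M h \<le> c \<longleftrightarrow> (\<integral>x. (h x)\<^sup>2 \<partial>M) \<le> c\<^sup>2"
  using assms by (metis l2_norm_nonneg l2_norm_power2 power2_le_imp_le power_mono)

text \<open>No measurability of \<open>f\<close> is demanded: if its square is not integrable, the
  left-hand side is 0 by the convention for Bochner integrals.\<close>

lemma l2_norm_mono:
  assumes "integrable M (\<lambda>x. (g x)\<^sup>2)" "AE x in M. \<bar>f x\<bar> \<le> \<bar>g x\<bar>"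
  shows "l2_norm M f \<le> l2_norm M g"
  unfolding l2_norm_def using assms
  by (intro real_sqrt_le_mono integral_mono_AE') (auto simp: abs_le_square_iff)

lemma integrable_mult_square_integrable:
  fixes f g :: "'a \<Rightarrow> real"
  assumes [measurable]: "f \<in> borel_measurable M" "g \<in> borel_measurable M"
    and f: "integrable M (\<lambda>x. (f x)\<^sup>2)" and g: "integrable M (\<lambda>x. (g x)\<^sup>2)"
  shows "integrable M (\<lambda>x. f x * g x)"
proof (rule Bochner_Integration.integrable_bound[OF Bochner_Integration.integrable_add[OF f g]])
  have "\<bar>a * b\<bar> \<le> a\<^sup>2 + b\<^sup>2" for a b :: real
  proof -
    have "2 * (\<bar>a\<bar> * \<bar>b\<bar>) \<le> a\<^sup>2 + b\<^sup>2"
      using sum_squares_bound[of "\<bar>a\<bar>" "\<bar>b\<bar>"] by (simp add: mult.assoc)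
    moreover have "0 \<le> \<bar>a\<bar> * \<bar>b\<bar>"
      by simp
    ultimately show ?thesis
      unfolding abs_mult by linarith
  qed
  then show "AE x in M. norm (f x * g x) \<le> norm ((f x)\<^sup>2 + (g x)\<^sup>2)"
    by simp
qed simp

lemma square_integrable_add:
  fixes f g :: "'a \<Rightarrow> real"
  assumes [measurable]: "f \<in> borel_measurable M" "g \<in> borel_measurable M"
    and "integrable M (\<lambda>x. (f x)\<^sup>2)" "integrable M (\<lambda>x. (g x)\<^sup>2)"
  shows "integrable M (\<lambda>x. (f x + g x)\<^sup>2)"
proof -
  have "integrable M (\<lambda>x. (f x)\<^sup>2 + (g x)\<^sup>2 + 2 * (f x * g x))"
    using assms(3,4) integrable_mult_square_integrable[OF assms]
    by (intro Bochner_Integration.integrable_add integrable_mult_right)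
  then show ?thesis
    by (simp add: power2_sum mult.assoc)
qed

lemma square_integrable_diff:
  fixes f g :: "'a \<Rightarrow> real"
  assumes [measurable]: "f \<in> borel_measurable M" "g \<in> borel_measurable M"
    and "integrable M (\<lambda>x. (f x)\<^sup>2)" "integrable M (\<lambda>x. (g x)\<^sup>2)"
  shows "integrable M (\<lambda>x. (f x - g x)\<^sup>2)"
  using square_integrable_add[of f M "\<lambda>x. - g x"] assms by simp

lemma square_integrable_sum:
  fixes f :: "'i \<Rightarrow> 'a \<Rightarrow> real"
  assumes "finite I" "\<And>i. i \<in> I \<Longrightarrow> f i \<in> borel_measurable M"
    "\<And>i. i \<in> I \<Longrightarrow> integrable M (\<lambda>x. (f i x)\<^sup>2)"
  shows "integrable M (\<lambda>x. (\<Sum>i\<in>I. f i x)\<^sup>2)"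
  using assms
proof (induction I)
  case (insert i I)
  then have "integrable M (\<lambda>x. (f i x + (\<Sum>i\<in>I. f i x))\<^sup>2)"
    by (intro square_integrable_add) auto
  with insert show ?case
    by simp
qed simp

lemma l2_cauchy_schwarz:
  fixes f g :: "'a \<Rightarrow> real"
  assumes [measurable]: "f \<in> borel_measurable M" "g \<in> borel_measurable M"
    and f: "integrable M (\<lambda>x. (f x)\<^sup>2)" and g: "integrable M (\<lambda>x. (g x)\<^sup>2)"
  shows "(\<integral>x. f x * g x \<partial>M) \<le> l2_norm M f * l2_norm M g"
proof -
  define a b c where "a = (\<integral>x. (f x)\<^sup>2 \<partial>M)" and "b = (\<integral>x. f x * g x \<partial>M)"
    and "c = (\<integral>x. (g x)\<^sup>2 \<partial>M)"
  note fg = integrable_mult_square_integrable[OF assms]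
  have quad: "0 \<le> a + 2 * t * b + t\<^sup>2 * c" for t
  proof -
    have "0 \<le> (\<integral>x. (f x + t * g x)\<^sup>2 \<partial>M)"
      by simp
    also have "\<dots> = (\<integral>x. (f x)\<^sup>2 + 2 * t * (f x * g x) + t\<^sup>2 * (g x)\<^sup>2 \<partial>M)"
      by (simp add: power2_sum power_mult_distrib algebra_simps)
    also have "\<dots> = a + 2 * t * b + t\<^sup>2 * c"
      using f g fg by (simp add: a_def b_def c_def)
    finally show ?thesis .
  qed
  have "0 \<le> a" "0 \<le> c"
    by (simp_all add: a_def c_def)
  have "b\<^sup>2 \<le> a * c"
  proof (cases "c = 0")
    case True
    have "b = 0"
    proof (rule ccontr)
      assume "b \<noteq> 0"
      then show False
        \<comment> \<open>For \<open>c = 0\<close> the quadratic is affine in \<open>t\<close>, and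
          at this \<open>t\<close> its value is -1.\<close>
        using quad[of "- (a + 1) / (2 * b)"] True by (simp add: field_simps)
    qed
    then show ?thesis
      using True by simp
  next
    case False
    then show ?thesis
      \<comment> \<open>The minimiser of the quadratic, where its value is a - b^2 / c.\<close>
      using quad[of "- b / c"] \<open>0 \<le> c\<close> by (simp add: field_simps power2_eq_square)
  qed
  then have "b \<le> sqrt (a * c)"
    by (rule real_le_rsqrt)
  then show ?thesis
    by (simp add: l2_norm_def a_def b_def c_def real_sqrt_mult)
qed

lemma l2_norm_triangle:
  fixes f g :: "'a \<Rightarrow> real"
  assumes [measurable]: "f \<in> borel_measurable M" "g \<in> borel_measurable M"
    and f: "integrable M (\<lambda>x. (f x)\<^sup>2)" and g: "integrable M (\<lambda>x. (g x)\<^sup>2)"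
  shows "l2_norm M (\<lambda>x. f x + g x) \<le> l2_norm M f + l2_norm M g"
proof (rule power2_le_imp_le)
  have "(l2_norm M (\<lambda>x. f x + g x))\<^sup>2 = (\<integral>x. (f x)\<^sup>2 + (g x)\<^sup>2 + 2 * (f x * g x) \<partial>M)"
    by (simp add: l2_norm_power2 power2_sum mult.assoc)
  also have "\<dots> = (l2_norm M f)\<^sup>2 + (l2_norm M g)\<^sup>2 + 2 * (\<integral>x. f x * g x \<partial>M)"
    using f g integrable_mult_square_integrable[OF assms] by (simp add: l2_norm_power2)
  also have "\<dots> \<le> (l2_norm M f + l2_norm M g)\<^sup>2"
    using l2_cauchy_schwarz[OF assms] by (simp add: power2_sum)
  finally show "(l2_norm M (\<lambda>x. f x + g x))\<^sup>2 \<le> (l2_norm M f + l2_norm M g)\<^sup>2" .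
qed simp

text \<open>Jensen's inequality for the square, in the form that a variance is nonnegative.\<close>

lemma (in prob_space) expectation_square_le:
  fixes f :: "'a \<Rightarrow> real"
  assumes "f \<in> borel_measurable M" "integrable M (\<lambda>x. (f x)\<^sup>2)"
  shows "(expectation f)\<^sup>2 \<le> expectation (\<lambda>x. (f x)\<^sup>2)"
  using variance_eq[OF square_integrable_imp_integrable[OF assms] assms(2)] variance_positive[of f]
  by linarith

lemma (in prob_space) square_integrable_bounded:
  fixes f :: "'a \<Rightarrow> real"
  assumes [measurable]: "f \<in> borel_measurable M" and "\<And>x. x \<in> space M \<Longrightarrow> \<bar>f x\<bar> \<le> C"
  shows "integrable M (\<lambda>x. (f x)\<^sup>2)"
proof (rule integrable_const_bound[of _ "C\<^sup>2"])
  show "AE x in M. norm ((f x)\<^sup>2) \<le> C\<^sup>2"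
    using assms(2) by (intro AE_I2) (metis abs_ge_zero norm_power power_mono real_norm_def)
qed simp

text \<open>Meant for a truncated estimate \<open>f\<close> times a possibly unbounded basis
  function \<open>g\<close>: the truncation is what gives the regressed products a second
  moment.\<close>

lemma square_integrable_bounded_mult:
  fixes f g :: "'a \<Rightarrow> real"
  assumes [measurable]: "f \<in> borel_measurable M" "g \<in> borel_measurable M"
    and f: "\<And>x. x \<in> space M \<Longrightarrow> \<bar>f x\<bar> \<le> C" and g: "integrable M (\<lambda>x. (g x)\<^sup>2)"
  shows "integrable M (\<lambda>x. (f x * g x)\<^sup>2)" "(\<integral>x. (f x * g x)\<^sup>2 \<partial>M) \<le> C\<^sup>2 * (\<integral>x. (g x)\<^sup>2 \<partial>M)"
proof -
  have le: "(f x * g x)\<^sup>2 \<le> C\<^sup>2 * (g x)\<^sup>2" if "x \<in> space M" for x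
    using f[OF that] by (simp add: power_mult_distrib mult_right_mono abs_le_square_iff[symmetric])
  have int: "integrable M (\<lambda>x. C\<^sup>2 * (g x)\<^sup>2)"
    using g by simp
  show *: "integrable M (\<lambda>x. (f x * g x)\<^sup>2)"
    using le by (intro Bochner_Integration.integrable_bound[OF int]) auto
  show "(\<integral>x. (f x * g x)\<^sup>2 \<partial>M) \<le> C\<^sup>2 * (\<integral>x. (g x)\<^sup>2 \<partial>M)"
    using integral_mono[OF * int le] by simp
qed

section \<open>Measurability in a Lipschitz parameter\<close>

text \<open>A Lipschitz function is the infimum of the cones above its graph with apex in a countable
  dense set.\<close>

lemma borel_measurable_lipschitz_parameter:
  fixes F :: "'a::{metric_space, second_countable_topology} \<Rightarrow> 'x \<Rightarrow> real"
  assumes meas [measurable]: "\<And>a. F a \<in> borel_measurable X"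
    and lip: "\<And>a b x. x \<in> space X \<Longrightarrow> \<bar>F a x - F b x\<bar> \<le> L * dist a b"
  shows "(\<lambda>(a, x). F a x) \<in> borel_measurable (borel \<Otimes>\<^sub>M X)"
proof -
  obtain Q :: "'a set" where "countable Q"
    and dense: "\<And>U. open U \<Longrightarrow> U \<noteq> {} \<Longrightarrow> \<exists>d\<in>Q. d \<in> U"
    using countable_dense_exists[where 'a='a] by auto
  then have "Q \<noteq> {}"
    by (metis UNIV_not_empty empty_iff open_UNIV)
  have below: "F a x \<le> F q x + L * dist a q" if "x \<in> space X" for a q x
    using lip[OF that, of a q] by linarith
  have "F a x = (INF q\<in>Q. F q x + L * dist a q)" if x: "x \<in> space X" for a x
  proof (rule antisym)
    show "F a x \<le> (INF q\<in>Q. F q x + L * dist a q)"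
      using \<open>Q \<noteq> {}\<close> below[OF x] by (intro cINF_greatest) auto
    show "(INF q\<in>Q. F q x + L * dist a q) \<le> F a x"
    proof (rule field_le_epsilon)
      fix e :: real
      assume "0 < e"
      \<comment> \<open>The Lipschitz bound is spent twice, once for comparing \<open>F q x\<close>
        with \<open>F a x\<close> and once for the cone term; adding 1 keeps the quotient defined
        for \<open>L = 0\<close>.\<close>
      define d where "d = e / (2 * (\<bar>L\<bar> + 1))"
      have "0 < d"
        using \<open>0 < e\<close> by (simp add: d_def add_pos_nonneg)
      then obtain q where q: "q \<in> Q" "dist a q < d"
        using dense[of "ball a d"] by auto
      have "(INF q\<in>Q. F q x + L * dist a q) \<le> F q x + L * dist a q"
        using q(1) below[OF x] by (intro cINF_lower bdd_belowI2[where m="F a x"]) auto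
      also have "\<dots> \<le> F a x + 2 * (L * dist a q)"
        using lip[OF x, of a q] by linarith
      also have "\<dots> \<le> F a x + 2 * ((\<bar>L\<bar> + 1) * d)"
        using q(2) by (intro add_left_mono mult_left_mono mult_mono) auto
      also have "\<dots> = F a x + e"
        by (simp add: d_def add_nonneg_pos field_simps)
      finally show "(INF q\<in>Q. F q x + L * dist a q) \<le> F a x + e" .
    qed
  qed
  then have "(\<lambda>(a, x). F a x) \<in> borel_measurable (borel \<Otimes>\<^sub>M X)
      \<longleftrightarrow> (\<lambda>(a, x). INF q\<in>Q. F q x + L * dist a q) \<in> borel_measurable (borel \<Otimes>\<^sub>M X)"
    by (intro measurable_cong) (auto simp: space_pair_measure)
  moreover have "(\<lambda>p. INF q\<in>Q. F q (snd p) + L * dist (fst p) q) \<in> borel_measurable (borel \<Otimes>\<^sub>M X)"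
    using below
    by (intro borel_measurable_cINF_real \<open>countable Q\<close>)
      (auto simp: space_pair_measure)
  ultimately show ?thesis
    by (simp add: case_prod_beta')
qed

section \<open>Sample means\<close>

text \<open>Distinct coordinates are independent and centred, so mixed moments vanish.\<close>

lemma (in prob_space) product_space_moments:
  fixes h :: "'a \<Rightarrow> real"
  assumes J: "finite J" and [measurable]: "h \<in> borel_measurable M"
    and h2: "integrable M (\<lambda>x. (h x)\<^sup>2)" and h0: "expectation h = 0"
    and i: "i \<in> J" and j: "j \<in> J"
  shows "integrable (\<Pi>\<^sub>M i\<in>J. M) (\<lambda>y. h (y i) * h (y j))"
    and "(\<integral>y. h (y i) * h (y j) \<partial>(\<Pi>\<^sub>M i\<in>J. M)) = (if i = j then expectation (\<lambda>x. (h x)\<^sup>2) else 0)"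
proof -
  have h: "integrable M h"
    using h2 by (rule square_integrable_imp_integrable[rotated]) simp
  interpret prod: product_prob_space "\<lambda>_. M" J ..
  \<comment> \<open>Writes the product of two evaluations as a product over all coordinates, with
    the constant 1 elsewhere, so that Fubini for products of one-coordinate functions applies. On
    the diagonal both factors sit in the same coordinate and give the square.\<close>
  define F where "F k = (if i = j then (if k = i then (\<lambda>x. (h x)\<^sup>2) else (\<lambda>_. 1))
    else (if k = i then h else if k = j then h else (\<lambda>_. 1)))" for k
  have F_int: "integrable M (F k)" for k
    using h h2 by (simp add: F_def)
  have "(\<Prod>k\<in>J. F k (y k)) = (\<Prod>k\<in>{i, j}. F k (y k))" for y
    using i j J by (intro prod.mono_neutral_right) (auto simp: F_def)
  then have F_prod: "(\<Prod>k\<in>J. F k (y k)) = h (y i) * h (y j)" for y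
    by (cases "i = j") (auto simp: F_def power2_eq_square)
  show "integrable (\<Pi>\<^sub>M i\<in>J. M) (\<lambda>y. h (y i) * h (y j))"
    using prod.product_integrable_prod[OF J, of F] F_int by (simp add: F_prod)
  have "(\<integral>y. h (y i) * h (y j) \<partial>(\<Pi>\<^sub>M i\<in>J. M)) = (\<Prod>k\<in>J. expectation (F k))"
    using prod.product_integral_prod[OF J, of F] F_int by (simp add: F_prod)
  also have "\<dots> = (\<Prod>k\<in>{i, j}. expectation (F k))"
    using i j J by (intro prod.mono_neutral_right) (auto simp: F_def prob_space)
  also have "\<dots> = (if i = j then expectation (\<lambda>x. (h x)\<^sup>2) else 0)"
    using h0 by (auto simp: F_def)
  finally show "(\<integral>y. h (y i) * h (y j) \<partial>(\<Pi>\<^sub>M i\<in>J. M)) = \<dots>" .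
qed

text \<open>After centring, only the diagonal of the expanded square survives, which leaves the
  variance divided by the sample size; the variance is at most the second moment.\<close>

lemma (in prob_space) sample_mean_error:
  fixes h :: "'a \<Rightarrow> real"
  assumes J: "finite J" "J \<noteq> {}" and [measurable]: "h \<in> borel_measurable M"
    and h2: "integrable M (\<lambda>x. (h x)\<^sup>2)"
  shows "integrable (\<Pi>\<^sub>M i\<in>J. M) (\<lambda>y. ((\<Sum>i\<in>J. h (y i)) / card J - expectation h)\<^sup>2)"
    and "(\<integral>y. ((\<Sum>i\<in>J. h (y i)) / card J - expectation h)\<^sup>2 \<partial>(\<Pi>\<^sub>M i\<in>J. M))
      \<le> expectation (\<lambda>x. (h x)\<^sup>2) / card J"
proof -
  define c where "c x = h x - expectation h" for x
  have [measurable]: "c \<in> borel_measurable M"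
    by (simp add: c_def[abs_def])
  have h: "integrable M h"
    using h2 by (rule square_integrable_imp_integrable[rotated]) simp
  have c2: "integrable M (\<lambda>x. (c x)\<^sup>2)"
    unfolding c_def using h2 by (intro square_integrable_diff) auto
  have c0: "expectation c = 0"
    using h by (simp add: c_def[abs_def] prob_space)
  have n: "real (card J) > 0"
    using J by (simp add: card_gt_0_iff)
  have "(\<Sum>i\<in>J. h (y i)) / card J - expectation h = (\<Sum>i\<in>J. c (y i)) / card J" for y
    using n by (simp add: c_def sum_subtractf field_simps)
  then have eq: "((\<Sum>i\<in>J. h (y i)) / card J - expectation h)\<^sup>2
      = (\<Sum>i\<in>J. \<Sum>j\<in>J. c (y i) * c (y j)) / (card J)\<^sup>2" for y
    by (simp add: power_divide power2_eq_square sum_product)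
  show "integrable (\<Pi>\<^sub>M i\<in>J. M) (\<lambda>y. ((\<Sum>i\<in>J. h (y i)) / card J - expectation h)\<^sup>2)"
    unfolding eq using product_space_moments(1)[OF J(1) _ c2 c0] by auto
  have "(\<integral>y. ((\<Sum>i\<in>J. h (y i)) / card J - expectation h)\<^sup>2 \<partial>(\<Pi>\<^sub>M i\<in>J. M))
      = (\<Sum>i\<in>J. \<Sum>j\<in>J. if i = j then expectation (\<lambda>x. (c x)\<^sup>2) else 0) / (card J)\<^sup>2"
    unfolding eq using product_space_moments[OF J(1) _ c2 c0]
    by (simp add: Bochner_Integration.integral_sum)
  also have "\<dots> = expectation (\<lambda>x. (c x)\<^sup>2) / card J"
    using n J(1) by (simp add: power2_eq_square)
  also have "\<dots> \<le> expectation (\<lambda>x. (h x)\<^sup>2) / card J"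
    using variance_eq[OF h h2] n by (intro divide_right_mono) (auto simp: c_def)
  finally show "(\<integral>y. ((\<Sum>i\<in>J. h (y i)) / card J - expectation h)\<^sup>2 \<partial>(\<Pi>\<^sub>M i\<in>J. M))
      \<le> expectation (\<lambda>x. (h x)\<^sup>2) / card J" .
qed

section \<open>Projection and regression onto the basis functions\<close>

locale l2_basis =
  fixes \<mu> :: "'x measure" and \<phi> :: "'k::finite \<Rightarrow> 'x \<Rightarrow> real"
  assumes phi_meas [measurable]: "\<And>k. \<phi> k \<in> borel_measurable \<mu>"
    and phi_L2: "\<And>k. integrable \<mu> (\<lambda>x. (\<phi> k x)\<^sup>2)"
    and phi_indep: "l2_independent \<mu> \<phi>"
begin

definition comb :: "real^'k \<Rightarrow> 'x \<Rightarrow> real" where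
  "comb c x = (\<Sum>k\<in>UNIV. c$k * \<phi> k x)"

text \<open>The right-hand side of the normal equations for projecting \<open>v\<close> onto the
  span of the basis.\<close>

definition moments :: "('x \<Rightarrow> real) \<Rightarrow> real^'k" where
  "moments v = (\<chi> k. \<integral>x. v x * \<phi> k x \<partial>\<mu>)"

definition inv_sqrt_norm :: real where
  "inv_sqrt_norm = onorm ((*v) (matrix_inv (matrix_sqrt (gram \<mu> \<phi>))))"

lemma inv_sqrt_norm_nonneg: "0 \<le> inv_sqrt_norm"
  unfolding inv_sqrt_norm_def by (intro onorm_pos_le matrix_vector_mul_bounded_linear)

lemma comb_measurable [measurable]: "comb c \<in> borel_measurable \<mu>"
  unfolding comb_def by measurable

lemma comb_L2: "integrable \<mu> (\<lambda>x. (comb c x)\<^sup>2)"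
  unfolding comb_def using phi_L2
  by (intro square_integrable_sum) (auto simp: power_mult_distrib)

lemma comb_diff: "comb (c - d) x = comb c x - comb d x"
  by (simp add: comb_def sum_subtractf left_diff_distrib)

lemma integral_mult_comb:
  assumes [measurable]: "v \<in> borel_measurable \<mu>" and "integrable \<mu> (\<lambda>x. (v x)\<^sup>2)"
  shows "(\<integral>x. v x * comb c x \<partial>\<mu>) = c \<bullet> moments v"
proof -
  have "integrable \<mu> (\<lambda>x. c$k * (v x * \<phi> k x))" for k
    using assms phi_L2 by (intro integrable_mult_right integrable_mult_square_integrable) auto
  then have "(\<integral>x. (\<Sum>k\<in>UNIV. c$k * (v x * \<phi> k x)) \<partial>\<mu>)
      = (\<Sum>k\<in>UNIV. c$k * (\<integral>x. v x * \<phi> k x \<partial>\<mu>))"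
    by (subst Bochner_Integration.integral_sum) auto
  then show ?thesis
    by (simp add: comb_def moments_def inner_vec_def sum_distrib_left mult.left_commute)
qed

lemma moments_comb: "moments (comb c) = gram \<mu> \<phi> *v c"
proof -
  have "(\<integral>x. comb c x * \<phi> k x \<partial>\<mu>) = c \<bullet> moments (\<phi> k)" for k
    using integral_mult_comb[of "\<phi> k" c] phi_L2 by (simp add: mult.commute)
  then show ?thesis
    by (simp add: moments_def gram_def matrix_vector_mult_def inner_vec_def vec_eq_iff mult.commute)
qed

lemma l2_norm_comb: "(l2_norm \<mu> (comb c))\<^sup>2 = c \<bullet> (gram \<mu> \<phi> *v c)"
  using integral_mult_comb[OF _ comb_L2, of c c]
  by (simp add: l2_norm_power2 moments_comb flip: power2_eq_square)

lemma comb_eq_0: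
  assumes "c \<bullet> (gram \<mu> \<phi> *v c) = 0"
  shows "c = 0"
proof -
  have "(\<integral>x. (comb c x)\<^sup>2 \<partial>\<mu>) = 0"
    using assms l2_norm_comb[of c] by (simp add: l2_norm_power2)
  then have "AE x in \<mu>. (comb c x)\<^sup>2 = 0"
    using comb_L2 by (subst (asm) integral_nonneg_eq_0_iff_AE) auto
  then show ?thesis
    using phi_indep by (simp add: l2_independent_def comb_def)
qed

text \<open>The constant is the minimum of the quadratic form on the unit sphere: attained by
  compactness, nonzero because linear independence (through \<open>comb_eq_0\<close>) excludes zeros
  there, and extended to all vectors by homogeneity.\<close>

lemma gram_pos_definite: "pos_definite (gram \<mu> \<phi>)"
proof -
  let ?q = "\<lambda>v. v \<bullet> (gram \<mu> \<phi> *v v)"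
  have "transpose (gram \<mu> \<phi>) = gram \<mu> \<phi>"
    by (simp add: transpose_def gram_def vec_eq_iff mult.commute)
  moreover have "\<exists>m>0. \<forall>v. m * (v \<bullet> v) \<le> ?q v"
  proof -
    have "continuous_on (sphere 0 1) ?q"
      by (intro continuous_intros linear_continuous_on matrix_vector_mul_bounded_linear)
    moreover have "sphere (0::real^'k) 1 \<noteq> {}"
      by simp
    ultimately obtain w where w: "w \<in> sphere 0 1" "\<And>v. v \<in> sphere 0 1 \<Longrightarrow> ?q w \<le> ?q v"
      using continuous_attains_inf[OF compact_sphere, of 0 1 ?q] by blast
    have "w \<noteq> 0"
      using w(1) by auto
    then have "?q w \<noteq> 0"
      using comb_eq_0 by blast
    moreover have "0 \<le> ?q w"
      using zero_le_power2[of "l2_norm \<mu> (comb w)"] by (simp add: l2_norm_comb)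
    ultimately have "0 < ?q w"
      by linarith
    moreover have "?q w * (v \<bullet> v) \<le> ?q v" for v
    proof (cases "v = 0")
      case False
      then have "?q w \<le> ?q ((1 / norm v) *\<^sub>R v)"
        by (intro w(2)) simp
      also have "\<dots> = ?q v / (norm v)\<^sup>2"
        by (simp add: matrix_vector_mult_scaleR power2_eq_square)
      finally show ?thesis
        using False by (simp add: field_simps power2_norm_eq_inner)
    qed simp
    ultimately show ?thesis
      by blast
  qed
  ultimately show ?thesis
    by (simp add: pos_definite_def)
qed

lemmas gram_inv = matrix_inv_mult[OF pos_definite_invertible[OF gram_pos_definite]]

text \<open>Orthogonality of the residual to every \<open>comb b\<close> says exactly that the
  coefficients solve the normal equations, and these have one solution because the Gram matrix is
  invertible.\<close>

lemma l2_proj_eq_comb: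
  assumes [measurable]: "v \<in> borel_measurable \<mu>" and v2: "integrable \<mu> (\<lambda>x. (v x)\<^sup>2)"
  shows "l2_proj \<mu> \<phi> v = comb (matrix_inv (gram \<mu> \<phi>) *v moments v)"
proof -
  have lin: "lin \<phi> = range comb"
    by (auto simp: lin_def comb_def[abs_def])
  have orth: "(\<integral>x. (v x - comb c x) * comb b x \<partial>\<mu>) = b \<bullet> (moments v - gram \<mu> \<phi> *v c)" for b c
  proof -
    have "(\<integral>x. (v x - comb c x) * comb b x \<partial>\<mu>)
        = (\<integral>x. v x * comb b x \<partial>\<mu>) - (\<integral>x. comb c x * comb b x \<partial>\<mu>)"
      using integrable_mult_square_integrable[OF _ _ v2 comb_L2]
        integrable_mult_square_integrable[OF _ _ comb_L2 comb_L2]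
      by (subst Bochner_Integration.integral_diff[symmetric]) (auto simp: left_diff_distrib)
    then show ?thesis
      using v2 comb_L2 by (simp add: integral_mult_comb moments_comb inner_diff_right)
  qed
  show ?thesis
    unfolding l2_proj_def lin
  proof (rule the_equality)
    fix h
    assume h: "h \<in> range comb \<and> (\<forall>b\<in>range comb. (\<integral>x. (v x - h x) * b x \<partial>\<mu>) = 0)"
    then obtain c where c: "h = comb c"
      by auto
    with h have "b \<bullet> (moments v - gram \<mu> \<phi> *v c) = 0" for b
      by (simp add: orth)
    then have "moments v - gram \<mu> \<phi> *v c = 0"
      by (metis inner_eq_zero_iff)
    then have "moments v = gram \<mu> \<phi> *v c"
      by simp
    then show "h = comb (matrix_inv (gram \<mu> \<phi>) *v moments v)"
      by (simp add: c gram_inv)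
  qed (auto simp: orth gram_inv)
qed

lemma l2_norm_comb_inv_gram_le:
  "l2_norm \<mu> (comb (matrix_inv (gram \<mu> \<phi>) *v d)) \<le> inv_sqrt_norm * norm d"
proof (rule power2_le_imp_le)
  show "(l2_norm \<mu> (comb (matrix_inv (gram \<mu> \<phi>) *v d)))\<^sup>2 \<le> (inv_sqrt_norm * norm d)\<^sup>2"
    unfolding l2_norm_comb inv_sqrt_norm_def
    by (rule quadratic_form_matrix_inv_le[OF gram_pos_definite])
qed (simp add: inv_sqrt_norm_nonneg)

text \<open>The residual is orthogonal to the projection h, so |h|^2 is the inner product of v and
  h; Cauchy-Schwarz then allows one factor |h| to be cancelled, the case |h| = 0 being
  trivial.\<close>

lemma l2_norm_proj_le:
  assumes [measurable]: "v \<in> borel_measurable \<mu>" and v2: "integrable \<mu> (\<lambda>x. (v x)\<^sup>2)"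
  shows "l2_norm \<mu> (comb (matrix_inv (gram \<mu> \<phi>) *v moments v)) \<le> l2_norm \<mu> v"
proof -
  define h where "h = comb (matrix_inv (gram \<mu> \<phi>) *v moments v)"
  have "(l2_norm \<mu> h)\<^sup>2 = (\<integral>x. v x * h x \<partial>\<mu>)"
    using v2 by (simp add: h_def l2_norm_comb integral_mult_comb gram_inv)
  also have "\<dots> \<le> l2_norm \<mu> v * l2_norm \<mu> h"
    using v2 comb_L2 by (intro l2_cauchy_schwarz) (auto simp: h_def)
  finally have "l2_norm \<mu> h * l2_norm \<mu> h \<le> l2_norm \<mu> v * l2_norm \<mu> h"
    by (simp add: power2_eq_square)
  then show ?thesis
    unfolding h_def[symmetric]
    by (metis l2_norm_nonneg mult_right_le_imp_le order_le_less)
qed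

text \<open>The error splits into the sampling error, the projection of \<open>v - v'\<close>, and the projection error of
  \<open>v'\<close>.\<close>

lemma regression_error:
  assumes [measurable]: "v \<in> borel_measurable \<mu>" "v' \<in> borel_measurable \<mu>"
    and v2: "integrable \<mu> (\<lambda>x. (v x)\<^sup>2)" and v2': "integrable \<mu> (\<lambda>x. (v' x)\<^sup>2)"
  shows "l2_norm \<mu> (\<lambda>x. comb (matrix_inv (gram \<mu> \<phi>) *v d) x - v' x)
    \<le> inv_sqrt_norm * norm (d - moments v) + l2_norm \<mu> (\<lambda>x. v x - v' x)
      + l2_norm \<mu> (\<lambda>x. l2_proj \<mu> \<phi> v' x - v' x)"
proof -
  define G where "G = matrix_inv (gram \<mu> \<phi>)"
  define a where "a = comb (G *v (d - moments v))"
  define b where "b = comb (G *v moments (\<lambda>x. v x - v' x))"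
  define c where "c x = comb (G *v moments v') x - v' x" for x
  have diff2: "integrable \<mu> (\<lambda>x. (v x - v' x)\<^sup>2)"
    using v2 v2' by (intro square_integrable_diff) auto
  have "integrable \<mu> (\<lambda>x. v x * \<phi> k x)" "integrable \<mu> (\<lambda>x. v' x * \<phi> k x)" for k
    using v2 v2' phi_L2 by (auto intro!: integrable_mult_square_integrable)
  then have "moments (\<lambda>x. v x - v' x) = moments v - moments v'"
    by (simp add: moments_def vec_eq_iff left_diff_distrib)
  \<comment> \<open>By linearity, \<open>d\<close> is telescoped as (d - moments v) + (moments v -
    moments v') + moments v'.\<close>
  then have split: "comb (G *v d) x - v' x = a x + b x + c x" for x
    by (simp add: a_def b_def c_def comb_diff matrix_vector_mult_diff_distrib)
  have [measurable]: "a \<in> borel_measurable \<mu>" "b \<in> borel_measurable \<mu>" "c \<in> borel_measurable \<mu>"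
    by (simp_all add: a_def b_def c_def[abs_def])
  have L2: "integrable \<mu> (\<lambda>x. (a x)\<^sup>2)" "integrable \<mu> (\<lambda>x. (b x)\<^sup>2)" "integrable \<mu> (\<lambda>x. (c x)\<^sup>2)"
    unfolding a_def b_def c_def using comb_L2 v2' square_integrable_diff[OF _ _ comb_L2 v2']
    by simp_all
  have "l2_norm \<mu> (\<lambda>x. a x + b x + c x) \<le> l2_norm \<mu> (\<lambda>x. a x + b x) + l2_norm \<mu> c"
    using L2 by (intro l2_norm_triangle square_integrable_add) auto
  also have "l2_norm \<mu> (\<lambda>x. a x + b x) \<le> l2_norm \<mu> a + l2_norm \<mu> b"
    using L2 by (intro l2_norm_triangle) auto
  also have "l2_norm \<mu> a \<le> inv_sqrt_norm * norm (d - moments v)"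
    unfolding a_def G_def by (rule l2_norm_comb_inv_gram_le)
  also have "l2_norm \<mu> b \<le> l2_norm \<mu> (\<lambda>x. v x - v' x)"
    unfolding b_def G_def using diff2 by (intro l2_norm_proj_le) auto
  also have "l2_norm \<mu> c = l2_norm \<mu> (\<lambda>x. l2_proj \<mu> \<phi> v' x - v' x)"
    by (simp add: c_def[abs_def] G_def l2_proj_eq_comb v2')
  finally show ?thesis
    by (simp add: split[symmetric] G_def)
qed

text \<open>The index type is left free because the training points of one time step are indexed by
  pairs.\<close>

definition sample_moments :: "'i set \<Rightarrow> ('x \<Rightarrow> real) \<Rightarrow> ('i \<Rightarrow> 'x) \<Rightarrow> real^'k" where
  "sample_moments J v y = (\<chi> k. (\<Sum>i\<in>J. v (y i) * \<phi> k (y i)) / card J)"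

text \<open>The squared Euclidean norm adds one sample-mean error for each basis function; this is
  the origin of the factor K.\<close>

lemma sample_moments_error:
  fixes C B :: real
  assumes "prob_space \<mu>" and J: "finite J" "J \<noteq> {}" and [measurable]: "v \<in> borel_measurable \<mu>"
    and v: "\<And>x. x \<in> space \<mu> \<Longrightarrow> \<bar>v x\<bar> \<le> C"
    and B: "\<And>k. l2_norm \<mu> (\<phi> k) \<le> B"
  shows "integrable (\<Pi>\<^sub>M i\<in>J. \<mu>) (\<lambda>y. (norm (sample_moments J v y - moments v))\<^sup>2)"
    and "(\<integral>y. (norm (sample_moments J v y - moments v))\<^sup>2 \<partial>(\<Pi>\<^sub>M i\<in>J. \<mu>))
      \<le> CARD('k) * (C * B)\<^sup>2 / card J"
proof -
  interpret prob_space \<mu> by fact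
  let ?e = "\<lambda>k y. (\<Sum>i\<in>J. v (y i) * \<phi> k (y i)) / card J - (\<integral>x. v x * \<phi> k x \<partial>\<mu>)"
  have eq: "(norm (sample_moments J v y - moments v))\<^sup>2 = (\<Sum>k\<in>UNIV. (?e k y)\<^sup>2)" for y
    by (simp add: norm_vec_def L2_set_def sum_nonneg sample_moments_def moments_def)
  have vphi: "integrable \<mu> (\<lambda>x. (v x * \<phi> k x)\<^sup>2)"
    "(\<integral>x. (v x * \<phi> k x)\<^sup>2 \<partial>\<mu>) \<le> C\<^sup>2 * (\<integral>x. (\<phi> k x)\<^sup>2 \<partial>\<mu>)" for k
    using square_integrable_bounded_mult[OF _ _ v phi_L2[of k]] by auto
  note e = sample_mean_error[OF J _ vphi(1)]
  show "integrable (\<Pi>\<^sub>M i\<in>J. \<mu>) (\<lambda>y. (norm (sample_moments J v y - moments v))\<^sup>2)"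
    unfolding eq using e(1) by auto
  have "(\<integral>y. (norm (sample_moments J v y - moments v))\<^sup>2 \<partial>(\<Pi>\<^sub>M i\<in>J. \<mu>))
      = (\<Sum>k\<in>UNIV. \<integral>y. (?e k y)\<^sup>2 \<partial>(\<Pi>\<^sub>M i\<in>J. \<mu>))"
    unfolding eq using e(1) by (subst Bochner_Integration.integral_sum) auto
  also have "\<dots> \<le> (\<Sum>k\<in>(UNIV :: 'k set). (C * B)\<^sup>2 / card J)"
  proof (rule sum_mono)
    fix k
    have "(\<integral>y. (?e k y)\<^sup>2 \<partial>(\<Pi>\<^sub>M i\<in>J. \<mu>)) \<le> C\<^sup>2 * (l2_norm \<mu> (\<phi> k))\<^sup>2 / card J"
      using e(2)[of k] vphi(2)[of k]
      by (intro order.trans[OF e(2)] divide_right_mono) (auto simp: l2_norm_power2)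
    also have "\<dots> \<le> (C * B)\<^sup>2 / card J"
      unfolding power_mult_distrib using B[of k]
      by (intro divide_right_mono mult_left_mono power_mono) auto
    finally show "(\<integral>y. (?e k y)\<^sup>2 \<partial>(\<Pi>\<^sub>M i\<in>J. \<mu>)) \<le> (C * B)\<^sup>2 / card J" .
  qed
  finally show "(\<integral>y. (norm (sample_moments J v y - moments v))\<^sup>2 \<partial>(\<Pi>\<^sub>M i\<in>J. \<mu>))
      \<le> CARD('k) * (C * B)\<^sup>2 / card J"
    by simp
qed

end

section \<open>Dynamic programming\<close>

text \<open>Independence makes the joint law a product, and Fubini integrates \<open>Y\<close> out
  with \<open>X\<close> frozen. This takes the place of conditioning on the current state.\<close>

lemma (in prob_space) indep_var_integral:
  fixes h :: "'b \<times> 'b \<Rightarrow> real"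
  assumes ind: "indep_var S X T Y" and h [measurable]: "h \<in> borel_measurable (S \<Otimes>\<^sub>M T)"
    and int: "integrable M (\<lambda>\<omega>. h (X \<omega>, Y \<omega>))"
  shows "(\<integral>\<omega>. h (X \<omega>, Y \<omega>) \<partial>M) = (\<integral>\<omega>. \<integral>\<omega>'. h (X \<omega>, Y \<omega>') \<partial>M \<partial>M)"
proof -
  have [measurable]: "X \<in> M \<rightarrow>\<^sub>M S" "Y \<in> M \<rightarrow>\<^sub>M T"
    and eq: "distr M S X \<Otimes>\<^sub>M distr M T Y = distr M (S \<Otimes>\<^sub>M T) (\<lambda>\<omega>. (X \<omega>, Y \<omega>))"
    using ind unfolding indep_var_distribution_eq by auto
  interpret X: prob_space "distr M S X" by (rule prob_space_distr) simp
  interpret Y: prob_space "distr M T Y" by (rule prob_space_distr) simp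
  interpret XY: pair_prob_space "distr M S X" "distr M T Y" ..
  have "integrable (distr M S X \<Otimes>\<^sub>M distr M T Y) h"
    unfolding eq using int by (subst integrable_distr_eq) auto
  then have "(\<integral>a. \<integral>b. h (a, b) \<partial>distr M T Y \<partial>distr M S X)
      = integral\<^sup>L (distr M S X \<Otimes>\<^sub>M distr M T Y) h"
    by (rule XY.integral_fst')
  moreover have "integral\<^sup>L (distr M S X \<Otimes>\<^sub>M distr M T Y) h = (\<integral>\<omega>. h (X \<omega>, Y \<omega>) \<partial>M)"
    unfolding eq by (subst integral_distr) auto
  moreover have "(\<integral>a. \<integral>b. h (a, b) \<partial>distr M T Y \<partial>distr M S X)
      = (\<integral>\<omega>. \<integral>b. h (X \<omega>, b) \<partial>distr M T Y \<partial>M)"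
    by (subst integral_distr) auto
  moreover have "(\<integral>b. h (X \<omega>, b) \<partial>distr M T Y) = (\<integral>\<omega>'. h (X \<omega>, Y \<omega>') \<partial>M)"
    if "\<omega> \<in> space M" for \<omega>
    using that by (subst integral_distr) (auto intro!: measurable_Pair1' measurable_compose[OF _ h] dest: measurable_space[of X])
  ultimately show ?thesis
    by (simp cong: Bochner_Integration.integral_cong)
qed

lemma (in prob_space) integrable_bounded:
  fixes h :: "'a \<Rightarrow> real"
  assumes "h \<in> borel_measurable M" "\<And>x. x \<in> space M \<Longrightarrow> \<bar>h x\<bar> \<le> C"
  shows "integrable M h"
  using assms by (intro integrable_const_bound[of _ C]) auto

lemma (in prob_space) abs_expectation_le:
  fixes h :: "'a \<Rightarrow> real"
  assumes [measurable]: "h \<in> borel_measurable M" and h: "\<And>x. x \<in> space M \<Longrightarrow> \<bar>h x\<bar> \<le> C"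
  shows "\<bar>expectation h\<bar> \<le> C"
proof -
  have int: "integrable M h"
    using assms by (rule integrable_bounded)
  have "h x \<le> C" "- C \<le> h x" if "x \<in> space M" for x
    using h[OF that] by linarith+
  then have "expectation h \<le> C" "- C \<le> expectation h"
    by (auto intro!: integral_le_const integral_ge_const int AE_I2)
  then show ?thesis
    by linarith
qed

text \<open>\<open>path\<close> recurses on the last step, whereas dynamic programming peels off the
  first one.\<close>

lemma path_shift:
  "path dyn w n x z (Suc j) = path dyn w (Suc n) (dyn n x (z n) (w n x)) z j"
  by (induction j) (simp_all add: Let_def)

lemma path_cong:
  assumes "\<And>i. n \<le> i \<Longrightarrow> i < n + j \<Longrightarrow> w i = w' i \<and> z i = z' i"
  shows "path dyn w n x z j = path dyn w' n x z' j"
  using assms by (induction j) (simp_all add: Let_def)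

section \<open>Rewards of a fixed policy and their one-step recursion\<close>

locale controlled_process = prob_space P
  for N :: nat and D :: "(real^'d) set" and DU :: "(real^'q) set"
    and P :: "'w measure" and \<xi> :: "nat \<Rightarrow> 'w \<Rightarrow> real"
    and dyn :: "nat \<Rightarrow> real^'d \<Rightarrow> real \<Rightarrow> real^'q \<Rightarrow> real^'d"
    and f :: "nat \<Rightarrow> real^'d \<Rightarrow> real^'q \<Rightarrow> real" and g :: "real^'d \<Rightarrow> real" +
  assumes DU_nonempty: "DU \<noteq> {}"
    and xi_indep: "indep_vars (\<lambda>_. borel) \<xi> {..<N}"
    and xi_range: "\<And>s \<omega>. s < N \<Longrightarrow> \<omega> \<in> space P \<Longrightarrow> \<xi> s \<omega> \<in> {0..1}"
    and dyn: "\<And>s. s < N \<Longrightarrow> (\<lambda>(x, z, u). dyn s x z u)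
        \<in> restrict_space borel D \<Otimes>\<^sub>M restrict_space borel {0..1} \<Otimes>\<^sub>M restrict_space borel DU
          \<rightarrow>\<^sub>M restrict_space borel D"
    and f_meas: "\<And>s. s < N \<Longrightarrow> (\<lambda>(x, u). f s x u)
        \<in> borel_measurable (restrict_space borel D \<Otimes>\<^sub>M restrict_space borel DU)"
    and f_bounded: "\<And>s. s < N \<Longrightarrow> bounded ((\<lambda>(x, u). f s x u) ` (D \<times> DU))"
    and g_meas: "g \<in> borel_measurable (restrict_space borel D)"
    and g_bounded: "bounded (g ` D)"
begin

abbreviation "BD \<equiv> restrict_space borel D"
abbreviation "BU \<equiv> restrict_space borel DU"
abbreviation "BI \<equiv> restrict_space borel {0..1::real}"
abbreviation "controls \<equiv> feedback_controls N D DU"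
abbreviation "J \<equiv> expected_reward P \<xi> N dyn f g"
abbreviation "V \<equiv> value_fn P \<xi> N D DU dyn f g"
abbreviation "NE \<equiv> next_expectation P \<xi> dyn"

text \<open>The pathwise reward as a function of the noise sequence: this makes it measurable on a
  product space and lets the noise be split into independent blocks.\<close>

definition reward :: "(nat \<Rightarrow> real^'d \<Rightarrow> real^'q) \<Rightarrow> nat \<Rightarrow> real^'d \<Rightarrow> (nat \<Rightarrow> real) \<Rightarrow> real" where
  "reward w n x z = (\<Sum>s\<in>{n..<N}. f s (path dyn w n x z (s - n)) (w s (path dyn w n x z (s - n))))
    + g (path dyn w n x z (N - n))"

lemma expected_reward_eq: "J w n x = (\<integral>\<omega>. reward w n x (\<lambda>i. \<xi> i \<omega>) \<partial>P)"
  by (simp add: expected_reward_def reward_def Let_def)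

lemma reward_step:
  assumes "n < N"
  shows "reward w n x z = f n x (w n x) + reward w (Suc n) (dyn n x (z n) (w n x)) z"
proof -
  have "{n..<N} = insert n {Suc n..<N}"
    using assms by auto
  moreover have "path dyn w n x z (s - n) = path dyn w (Suc n) (dyn n x (z n) (w n x)) z (s - Suc n)"
    if "Suc n \<le> s" for s
    using path_shift[of dyn w n x z "s - Suc n"] that by (metis Suc_diff_le diff_Suc_Suc)
  ultimately show ?thesis
    using assms by (simp add: reward_def)
qed

lemma reward_cong:
  assumes "\<And>i. n \<le> i \<Longrightarrow> i < N \<Longrightarrow> w i = w' i \<and> z i = z' i" "n \<le> N"
  shows "reward w n x z = reward w' n x z'"
proof -
  have "path dyn w n x z (s - n) = path dyn w' n x z' (s - n)" if "n \<le> s" "s \<le> N" for s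
    using assms that by (intro path_cong) auto
  then show ?thesis
    using assms by (simp add: reward_def)
qed

lemma expected_reward_cong:
  assumes "\<And>i. n \<le> i \<Longrightarrow> i < N \<Longrightarrow> w i = w' i" "n \<le> N"
  shows "J w n x = J w' n x"
  unfolding expected_reward_eq using assms
  by (intro Bochner_Integration.integral_cong refl reward_cong) auto

lemma control_measurable:
  assumes "w \<in> controls" "s < N"
  shows "w s \<in> BD \<rightarrow>\<^sub>M BU"
  using assms by (simp add: feedback_controls_def)

lemma dyn_measurable:
  assumes "s < N" "X \<in> M \<rightarrow>\<^sub>M BD" "Z \<in> M \<rightarrow>\<^sub>M BI" "U \<in> M \<rightarrow>\<^sub>M BU"
  shows "(\<lambda>a. dyn s (X a) (Z a) (U a)) \<in> M \<rightarrow>\<^sub>M BD"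
  using measurable_compose[OF measurable_Pair[OF assms(2) measurable_Pair[OF assms(3,4)]] dyn[OF assms(1)]]
  by simp

lemma f_measurable:
  assumes "s < N" "X \<in> M \<rightarrow>\<^sub>M BD" "U \<in> M \<rightarrow>\<^sub>M BU"
  shows "(\<lambda>a. f s (X a) (U a)) \<in> borel_measurable M"
  using measurable_compose[OF measurable_Pair[OF assms(2,3)] f_meas[OF assms(1)]]
  by simp

lemma xi_measurable:
  assumes "s < N"
  shows "\<xi> s \<in> P \<rightarrow>\<^sub>M BI"
  using xi_indep assms xi_range
  by (intro measurable_restrict_space2) (auto simp: indep_vars_def2)

text \<open>The dynamics are measurable only for noise in the unit interval, so independence is
  restated for the smaller sigma-algebra.\<close>

lemma xi_indep_restrict: "indep_vars (\<lambda>_. BI) \<xi> {..<N}"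
  unfolding indep_vars_def2
proof (intro conjI ballI)
  have "indep_sets (\<lambda>i. {\<xi> i -` A \<inter> space P |A. A \<in> sets borel}) {..<N}"
    using xi_indep by (simp add: indep_vars_def2)
  then show "indep_sets (\<lambda>i. {\<xi> i -` A \<inter> space P |A. A \<in> sets BI}) {..<N}"
    by (rule indep_sets_mono_sets) (auto simp: sets_restrict_space_iff)
qed (auto intro: xi_measurable)

lemma noise_measurable:
  assumes "I \<subseteq> {..<N}"
  shows "(\<lambda>\<omega>. \<lambda>i\<in>I. \<xi> i \<omega>) \<in> P \<rightarrow>\<^sub>M (\<Pi>\<^sub>M i\<in>I. BI)"
  using assms xi_measurable by (intro measurable_restrict) auto

lemma path_measurable:
  assumes w: "w \<in> controls" and "n + j \<le> N"
  shows "(\<lambda>(x, z). path dyn w n x z j) \<in> BD \<Otimes>\<^sub>M (\<Pi>\<^sub>M i\<in>{n..<N}. BI) \<rightarrow>\<^sub>M BD"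
  using assms(2)
proof (induction j)
  case (Suc j)
  let ?M = "BD \<Otimes>\<^sub>M (\<Pi>\<^sub>M i\<in>{n..<N}. BI)"
  define Y where "Y = (\<lambda>p. path dyn w n (fst p) (snd p) j)"
  have Y: "Y \<in> ?M \<rightarrow>\<^sub>M BD"
    using Suc by (simp add: Y_def case_prod_beta')
  have Z: "(\<lambda>p. snd p (n + j)) \<in> ?M \<rightarrow>\<^sub>M BI"
    using Suc.prems
    by (intro measurable_compose[OF measurable_snd] measurable_component_singleton) auto
  have "(\<lambda>p. dyn (n + j) (Y p) (snd p (n + j)) (w (n + j) (Y p))) \<in> ?M \<rightarrow>\<^sub>M BD"
    using Suc.prems
    by (intro dyn_measurable Y Z measurable_compose[OF Y] control_measurable[OF w]) auto
  then show ?case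
    by (simp add: Y_def case_prod_beta' Let_def)
qed simp

lemma reward_measurable:
  assumes w: "w \<in> controls" and "n \<le> N"
  shows "(\<lambda>p. reward w n (fst p) (snd p)) \<in> borel_measurable (BD \<Otimes>\<^sub>M (\<Pi>\<^sub>M i\<in>{n..<N}. BI))"
proof -
  have Y: "(\<lambda>p. path dyn w n (fst p) (snd p) (s - n)) \<in> BD \<Otimes>\<^sub>M (\<Pi>\<^sub>M i\<in>{n..<N}. BI) \<rightarrow>\<^sub>M BD"
    if "n \<le> s" "s \<le> N" for s
    using path_measurable[OF w, of n "s - n"] that by (simp add: case_prod_beta')
  show ?thesis
    unfolding reward_def using assms(2)
    by (intro borel_measurable_add borel_measurable_sum f_measurable Y measurable_compose[OF Y]
        control_measurable[OF w] g_meas) auto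
qed


lemma f_bound:
  obtains C where "\<And>s x u. s < N \<Longrightarrow> x \<in> D \<Longrightarrow> u \<in> DU \<Longrightarrow> \<bar>f s x u\<bar> \<le> C"
proof -
  have "\<exists>c. \<forall>x\<in>D. \<forall>u\<in>DU. \<bar>f s x u\<bar> \<le> c" if "s < N" for s
    using f_bounded[OF that] by (force simp: bounded_iff)
  then obtain Cf where Cf: "\<And>s x u. s < N \<Longrightarrow> x \<in> D \<Longrightarrow> u \<in> DU \<Longrightarrow> \<bar>f s x u\<bar> \<le> Cf s"
    by metis
  have "\<bar>f s x u\<bar> \<le> (\<Sum>s<N. \<bar>Cf s\<bar>)" if "s < N" "x \<in> D" "u \<in> DU" for s x u
    using member_le_sum[of s "{..<N}" "\<lambda>s. \<bar>Cf s\<bar>"] Cf[OF that] that by simp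
  then show ?thesis
    using that by blast
qed

lemma reward_bounded:
  obtains C where "\<And>n w x z. n \<le> N \<Longrightarrow> w \<in> controls \<Longrightarrow> x \<in> D \<Longrightarrow> z \<in> space (\<Pi>\<^sub>M i\<in>{n..<N}. BI)
      \<Longrightarrow> \<bar>reward w n x z\<bar> \<le> C"
proof -
  obtain Cf where Cf: "\<And>s x u. s < N \<Longrightarrow> x \<in> D \<Longrightarrow> u \<in> DU \<Longrightarrow> \<bar>f s x u\<bar> \<le> Cf"
    using f_bound by blast
  obtain Cg where Cg: "\<And>x. x \<in> D \<Longrightarrow> \<bar>g x\<bar> \<le> Cg"
    using g_bounded by (auto simp: bounded_iff)
  have "\<bar>reward w n x z\<bar> \<le> N * \<bar>Cf\<bar> + Cg"
    if "n \<le> N" and w: "w \<in> controls" and x: "x \<in> D" and z: "z \<in> space (\<Pi>\<^sub>M i\<in>{n..<N}. BI)" for n w x z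
  proof -
    have path_D: "path dyn w n x z (s - n) \<in> D" if "n \<le> s" "s \<le> N" for s
      using measurable_space[OF path_measurable[OF w, of n "s - n"], of "(x, z)"] that x z
      by (simp add: space_pair_measure space_restrict_space)
    have "\<bar>f s (path dyn w n x z (s - n)) (w s (path dyn w n x z (s - n)))\<bar> \<le> \<bar>Cf\<bar>"
      if "s \<in> {n..<N}" for s
      using that measurable_space[OF control_measurable[OF w, of s]] path_D[of s]
      by (intro order.trans[OF Cf abs_ge_self]) (auto simp: space_restrict_space)
    then have "\<bar>\<Sum>s\<in>{n..<N}. f s (path dyn w n x z (s - n)) (w s (path dyn w n x z (s - n)))\<bar>
        \<le> (\<Sum>s\<in>{n..<N}. \<bar>Cf\<bar>)"
      by (intro order.trans[OF sum_abs] sum_mono) auto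
    also have "\<dots> \<le> N * \<bar>Cf\<bar>"
      by (simp add: mult_right_mono)
    finally show ?thesis
      unfolding reward_def using Cg[OF path_D[of N]] \<open>n \<le> N\<close>
      by (intro order.trans[OF abs_triangle_ineq] add_mono) auto
  qed
  then show ?thesis
    using that by blast
qed

lemma noise_in_space:
  assumes "\<omega> \<in> space P"
  shows "(\<lambda>i\<in>{n..<N}. \<xi> i \<omega>) \<in> space (\<Pi>\<^sub>M i\<in>{n..<N}. BI)"
  by (rule measurable_space[OF noise_measurable assms]) auto

lemma reward_restrict:
  assumes "n \<le> N"
  shows "reward w n x (\<lambda>i\<in>{n..<N}. z i) = reward w n x z"
  using assms by (intro reward_cong) auto

lemma reward_noise_measurable:
  assumes w: "w \<in> controls" and n: "n \<le> N" and X: "X \<in> M \<rightarrow>\<^sub>M BD" and Z: "Z \<in> M \<rightarrow>\<^sub>M P"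
  shows "(\<lambda>a. reward w n (X a) (\<lambda>i. \<xi> i (Z a))) \<in> borel_measurable M"
proof -
  have "(\<lambda>a. (X a, \<lambda>i\<in>{n..<N}. \<xi> i (Z a))) \<in> M \<rightarrow>\<^sub>M BD \<Otimes>\<^sub>M (\<Pi>\<^sub>M i\<in>{n..<N}. BI)"
    by (intro measurable_Pair X measurable_compose[OF Z noise_measurable]) auto
  from measurable_compose[OF this reward_measurable[OF w n]] show ?thesis
    using n by (simp add: reward_restrict)
qed

lemma reward_noise_bounded:
  obtains C where "\<And>n w x \<omega>. n \<le> N \<Longrightarrow> w \<in> controls \<Longrightarrow> x \<in> D \<Longrightarrow> \<omega> \<in> space P
      \<Longrightarrow> \<bar>reward w n x (\<lambda>i. \<xi> i \<omega>)\<bar> \<le> C"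
proof -
  obtain C where C: "\<And>n w x z. n \<le> N \<Longrightarrow> w \<in> controls \<Longrightarrow> x \<in> D
      \<Longrightarrow> z \<in> space (\<Pi>\<^sub>M i\<in>{n..<N}. BI) \<Longrightarrow> \<bar>reward w n x z\<bar> \<le> C"
    using reward_bounded by blast
  have "\<bar>reward w n x (\<lambda>i. \<xi> i \<omega>)\<bar> \<le> C"
    if "n \<le> N" "w \<in> controls" "x \<in> D" "\<omega> \<in> space P" for n w x \<omega>
    using C[OF that(1-3) noise_in_space[OF that(4)]] that(1) by (simp add: reward_restrict)
  then show ?thesis
    using that by blast
qed

lemma expected_reward_bounded:
  obtains C where "\<And>n w x. n \<le> N \<Longrightarrow> w \<in> controls \<Longrightarrow> x \<in> D \<Longrightarrow> \<bar>J w n x\<bar> \<le> C"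
proof -
  obtain C where C: "\<And>n w x \<omega>. n \<le> N \<Longrightarrow> w \<in> controls \<Longrightarrow> x \<in> D \<Longrightarrow> \<omega> \<in> space P
      \<Longrightarrow> \<bar>reward w n x (\<lambda>i. \<xi> i \<omega>)\<bar> \<le> C"
    using reward_noise_bounded by blast
  have "\<bar>J w n x\<bar> \<le> C" if "n \<le> N" "w \<in> controls" "x \<in> D" for n w x
    unfolding expected_reward_eq using that C
    by (intro abs_expectation_le reward_noise_measurable) (auto simp: space_restrict_space)
  then show ?thesis
    using that by blast
qed

lemma expected_reward_measurable:
  assumes "w \<in> controls" "n \<le> N"
  shows "J w n \<in> borel_measurable BD"
proof -
  have "(\<lambda>p. reward w n (fst p) (\<lambda>i. \<xi> i (snd p))) \<in> borel_measurable (BD \<Otimes>\<^sub>M P)"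
    using assms by (intro reward_noise_measurable) auto
  then have "(\<lambda>x. \<integral>\<omega>. reward w n x (\<lambda>i. \<xi> i \<omega>) \<partial>P) \<in> borel_measurable BD"
    by (intro borel_measurable_lebesgue_integral) (simp add: case_prod_beta')
  then show ?thesis
    by (simp add: expected_reward_eq[abs_def])
qed

lemma next_state_measurable:
  assumes "n < N" "x \<in> D" "u \<in> DU"
  shows "(\<lambda>\<omega>. dyn n x (\<xi> n \<omega>) u) \<in> P \<rightarrow>\<^sub>M BD"
  using assms by (intro dyn_measurable xi_measurable measurable_const) (auto simp: space_restrict_space)

lemma control_in:
  assumes "w \<in> controls" "n < N" "x \<in> D"
  shows "w n x \<in> DU"
  using measurable_space[OF control_measurable[OF assms(1,2)], of x] assms(3)
  by (simp add: space_restrict_space)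

lemma expected_reward_step:
  assumes n: "n < N" and w: "w \<in> controls" and x: "x \<in> D"
  shows "J w n x = f n x (w n x) + NE (J w (Suc n)) n x (w n x)"
proof -
  \<comment> \<open>The current noise is kept as a family over a singleton, so that the present and
    the future are both restrictions of the one independent sequence.\<close>
  let ?I = "{n}" and ?K = "{Suc n..<N}"
  let ?S = "\<Pi>\<^sub>M i\<in>?I. BI" and ?T = "\<Pi>\<^sub>M i\<in>?K. BI"
  let ?X = "\<lambda>\<omega>. \<lambda>i\<in>?I. \<xi> i \<omega>" and ?Y = "\<lambda>\<omega>. \<lambda>i\<in>?K. \<xi> i \<omega>"
  define h where "h p = reward w (Suc n) (dyn n x (fst p n) (w n x)) (snd p)"
    for p :: "(nat \<Rightarrow> real) \<times> (nat \<Rightarrow> real)"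
  have u: "w n x \<in> DU"
    using control_in[OF w n x] .
  have ind: "indep_var ?S ?X ?T ?Y"
    using n by (intro indep_var_restrict[OF xi_indep_restrict]) auto
  have Z: "(\<lambda>p. fst p n) \<in> ?S \<Otimes>\<^sub>M ?T \<rightarrow>\<^sub>M BI"
    by (intro measurable_compose[OF measurable_fst] measurable_component_singleton) auto
  have "(\<lambda>p. (dyn n x (fst p n) (w n x), snd p)) \<in> ?S \<Otimes>\<^sub>M ?T \<rightarrow>\<^sub>M BD \<Otimes>\<^sub>M ?T"
    using n x u by (intro measurable_Pair dyn_measurable Z measurable_const measurable_snd)
      (auto simp: space_restrict_space)
  from measurable_compose[OF this reward_measurable[OF w, of "Suc n"]] n
  have h_meas: "h \<in> borel_measurable (?S \<Otimes>\<^sub>M ?T)"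
    by (simp add: h_def[abs_def])
  have h_eq: "h (?X \<omega>, ?Y \<omega>') = reward w (Suc n) (dyn n x (\<xi> n \<omega>) (w n x)) (\<lambda>i. \<xi> i \<omega>')" for \<omega> \<omega>'
    using n by (simp add: h_def reward_restrict)
  obtain C where C: "\<And>n w x \<omega>. n \<le> N \<Longrightarrow> w \<in> controls \<Longrightarrow> x \<in> D \<Longrightarrow> \<omega> \<in> space P
      \<Longrightarrow> \<bar>reward w n x (\<lambda>i. \<xi> i \<omega>)\<bar> \<le> C"
    using reward_noise_bounded by blast
  have X': "dyn n x (\<xi> n \<omega>) (w n x) \<in> D" if "\<omega> \<in> space P" for \<omega>
    using measurable_space[OF next_state_measurable[OF n x u] that] by (simp add: space_restrict_space)
  have int: "integrable P (\<lambda>\<omega>. h (?X \<omega>, ?Y \<omega>))"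
    unfolding h_eq
    by (rule integrable_bounded[OF reward_noise_measurable[OF w Suc_leI[OF n]
          next_state_measurable[OF n x u] measurable_id] C[OF Suc_leI[OF n] w X']])
  have "J w n x = (\<integral>\<omega>. f n x (w n x) + h (?X \<omega>, ?Y \<omega>) \<partial>P)"
    unfolding expected_reward_eq h_eq using n by (simp add: reward_step)
  also have "\<dots> = f n x (w n x) + (\<integral>\<omega>. h (?X \<omega>, ?Y \<omega>) \<partial>P)"
    using int by (simp add: prob_space)
  also have "(\<integral>\<omega>. h (?X \<omega>, ?Y \<omega>) \<partial>P) = (\<integral>\<omega>. \<integral>\<omega>'. h (?X \<omega>, ?Y \<omega>') \<partial>P \<partial>P)"
    by (rule indep_var_integral[OF ind h_meas int])
  also have "\<dots> = NE (J w (Suc n)) n x (w n x)"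
    unfolding h_eq by (simp add: next_expectation_def expected_reward_eq)
  finally show ?thesis .
qed

lemma const_control:
  assumes "u \<in> DU"
  shows "(\<lambda>_. u) \<in> BD \<rightarrow>\<^sub>M BU"
  using assms by (intro measurable_const) (simp add: space_restrict_space)

lemma controls_nonempty: "controls \<noteq> {}"
proof -
  obtain u where "u \<in> DU"
    using DU_nonempty by auto
  then have "(\<lambda>_ _. u) \<in> controls"
    using const_control by (simp add: feedback_controls_def)
  then show ?thesis
    by auto
qed

lemma controls_update:
  assumes "w \<in> controls" "v \<in> BD \<rightarrow>\<^sub>M BU"
  shows "w(n := v) \<in> controls"
  using assms by (simp add: feedback_controls_def)

lemma expected_reward_le_value:
  assumes "w \<in> controls" "n \<le> N" "x \<in> D"
  shows "J w n x \<le> V n x"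
proof -
  obtain C where "\<And>n w x. n \<le> N \<Longrightarrow> w \<in> controls \<Longrightarrow> x \<in> D \<Longrightarrow> \<bar>J w n x\<bar> \<le> C"
    using expected_reward_bounded by blast
  then show ?thesis
    unfolding value_fn_def using assms
    by (intro cSUP_upper bdd_aboveI2[where M=C]) (auto dest: abs_le_D1)
qed

lemma value_terminal: "V N x = g x"
proof -
  have "J w N x = g x" for w
    by (simp add: expected_reward_eq reward_def prob_space)
  then show ?thesis
    using controls_nonempty by (simp add: value_fn_def)
qed

lemma abs_next_expectation_le:
  assumes n: "n < N" and x: "x \<in> D" and u: "u \<in> DU"
    and h: "h \<in> borel_measurable BD" "\<And>y. y \<in> D \<Longrightarrow> \<bar>h y\<bar> \<le> C"
  shows "\<bar>NE h n x u\<bar> \<le> C"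
proof -
  have X: "dyn n x (\<xi> n \<omega>) u \<in> D" if "\<omega> \<in> space P" for \<omega>
    using measurable_space[OF next_state_measurable[OF n x u] that] by (simp add: space_restrict_space)
  show ?thesis
    unfolding next_expectation_def using h X
    by (intro abs_expectation_le measurable_compose[OF next_state_measurable[OF n x u]]) auto
qed

end

section \<open>Transition densities and the Bellman equation\<close>

locale controlled_density = controlled_process N D DU P \<xi> dyn f g
  for N :: nat and D :: "(real^'d) set" and DU :: "(real^'q) set"
    and P :: "'w measure" and \<xi> :: "nat \<Rightarrow> 'w \<Rightarrow> real"
    and dyn :: "nat \<Rightarrow> real^'d \<Rightarrow> real \<Rightarrow> real^'q \<Rightarrow> real^'d"
    and f :: "nat \<Rightarrow> real^'d \<Rightarrow> real^'q \<Rightarrow> real" and g :: "real^'d \<Rightarrow> real" +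
  fixes \<mu> :: "(real^'d) measure" and r :: "nat \<Rightarrow> real^'d \<Rightarrow> real^'q \<Rightarrow> real^'d \<Rightarrow> real"
    and R \<Gamma> :: real
  assumes mu: "prob_space \<mu>" "sets \<mu> = sets (restrict_space borel D)"
    and r_density: "\<And>s x u. s < N \<Longrightarrow> x \<in> D \<Longrightarrow> u \<in> DU
        \<Longrightarrow> distributed P \<mu> (\<lambda>\<omega>. dyn s x (\<xi> s \<omega>) u) (\<lambda>y. ennreal (r s x u y))"
    and R_pos: "0 < R"
    and r_bound: "\<And>s x u y. s < N \<Longrightarrow> x \<in> D \<Longrightarrow> u \<in> DU \<Longrightarrow> y \<in> D
        \<Longrightarrow> 0 \<le> r s x u y \<and> r s x u y \<le> R\<^sup>2"
    and Gamma: "\<And>s x. s \<le> N \<Longrightarrow> x \<in> D \<Longrightarrow> \<bar>V s x\<bar> \<le> \<Gamma>"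
    and V_meas: "\<And>s. s \<le> N \<Longrightarrow> V s \<in> borel_measurable (restrict_space borel D)"
    and V_select: "\<And>s e. s < N \<Longrightarrow> 0 < e \<Longrightarrow>
        \<exists>w \<in> restrict_space borel D \<rightarrow>\<^sub>M restrict_space borel DU. AE x in \<mu>. \<forall>u\<in>DU.
          f s x u + NE (V (Suc s)) s x u \<le> f s x (w x) + NE (V (Suc s)) s x (w x) + e"
begin

lemma space_mu: "space \<mu> = D"
  using sets_eq_imp_space_eq[OF mu(2)] by (simp add: space_restrict_space)

lemma measurable_mu: "borel_measurable \<mu> = borel_measurable BD"
  using mu(2) by (rule measurable_cong_sets) simp

text \<open>A law with a density does not charge null sets of \<mu>. Hence almost-everywhere
  optimality at the next time suffices for every current state and control.\<close>

lemma next_state_AE: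
  assumes "n < N" "x \<in> D" "u \<in> DU" and "AE y in \<mu>. Q y"
  shows "AE \<omega> in P. Q (dyn n x (\<xi> n \<omega>) u)"
proof -
  note d = r_density[OF assms(1-3)]
  have "AE y in density \<mu> (\<lambda>y. ennreal (r n x u y)). Q y"
    using assms(4) distributed_borel_measurable[OF d] by (subst AE_density) auto
  then show ?thesis
    unfolding distributed_distr_eq_density[OF d, symmetric]
    by (rule AE_distrD[OF distributed_measurable[OF d]])
qed

lemma next_expectation_ge:
  assumes n: "n < N" and x: "x \<in> D" and u: "u \<in> DU"
    and h: "h \<in> borel_measurable BD" "\<And>y. y \<in> D \<Longrightarrow> \<bar>h y\<bar> \<le> C"
    and h': "h' \<in> borel_measurable BD" "\<And>y. y \<in> D \<Longrightarrow> \<bar>h' y\<bar> \<le> C'"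
    and le: "AE y in \<mu>. h y - c \<le> h' y"
  shows "NE h n x u - c \<le> NE h' n x u"
proof -
  note X = next_state_measurable[OF n x u]
  have X_D: "dyn n x (\<xi> n \<omega>) u \<in> D" if "\<omega> \<in> space P" for \<omega>
    using measurable_space[OF X that] by (simp add: space_restrict_space)
  have int: "integrable P (\<lambda>\<omega>. h (dyn n x (\<xi> n \<omega>) u))"
    "integrable P (\<lambda>\<omega>. h' (dyn n x (\<xi> n \<omega>) u))"
    using h h' X_D by (auto intro!: integrable_bounded measurable_compose[OF X])
  have "(\<integral>\<omega>. h (dyn n x (\<xi> n \<omega>) u) - c \<partial>P) \<le> (\<integral>\<omega>. h' (dyn n x (\<xi> n \<omega>) u) \<partial>P)"
    using int next_state_AE[OF n x u le] by (intro integral_mono_AE) auto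
  then show ?thesis
    using int(1) by (simp add: next_expectation_def prob_space)
qed

lemma expected_reward_le_step:
  assumes n: "n < N" and w: "w \<in> controls" and x: "x \<in> D"
  shows "J w n x \<le> f n x (w n x) + NE (V (Suc n)) n x (w n x)"
proof -
  obtain C where C: "\<And>n w x. n \<le> N \<Longrightarrow> w \<in> controls \<Longrightarrow> x \<in> D \<Longrightarrow> \<bar>J w n x\<bar> \<le> C"
    using expected_reward_bounded by blast
  note n1 = Suc_leI[OF n]
  have le: "AE y in \<mu>. J w (Suc n) y - 0 \<le> V (Suc n) y"
  proof (rule AE_I2)
    fix y
    assume "y \<in> space \<mu>"
    then have "y \<in> D"
      by (simp add: space_mu)
    then show "J w (Suc n) y - 0 \<le> V (Suc n) y"
      using expected_reward_le_value[OF w n1] by simp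
  qed
  have "NE (J w (Suc n)) n x (w n x) - 0 \<le> NE (V (Suc n)) n x (w n x)"
    by (rule next_expectation_ge[where h="J w (Suc n)" and h'="V (Suc n)" and c=0,
          OF n x control_in[OF w n x] expected_reward_measurable[OF w n1] C[OF n1 w]
          V_meas[OF n1] Gamma[OF n1] le])
  then show ?thesis
    using expected_reward_step[OF assms] by linarith
qed

text \<open>An \<open>e\<close>-optimal policy for almost every initial state is enough, because the next state has a
  density.\<close>

lemma near_optimal_control:
  assumes "n \<le> N" "0 < e"
  shows "\<exists>w\<in>controls. AE x in \<mu>. V n x - e \<le> J w n x"
  using assms
proof (induction n arbitrary: e rule: inc_induct)
  case base
  have "J w N x = g x" for w x
    by (simp add: expected_reward_eq reward_def prob_space)
  then show ?case
    using controls_nonempty base by (auto simp: value_terminal)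
next
  case (step n)
  obtain w' where w': "w' \<in> controls" and opt: "AE x in \<mu>. V (Suc n) x - e / 2 \<le> J w' (Suc n) x"
    using step.IH[of "e / 2"] step.prems by auto
  obtain v where v: "v \<in> BD \<rightarrow>\<^sub>M BU"
    and v_opt: "AE x in \<mu>. \<forall>u\<in>DU. f n x u + NE (V (Suc n)) n x u
      \<le> f n x (v x) + NE (V (Suc n)) n x (v x) + e / 2"
    using V_select[OF step(2) half_gt_zero[OF step.prems]] by blast
  note n1 = Suc_leI[OF step(2)]
  \<comment> \<open>Overwriting the policy at time \<open>n\<close> leaves its rewards from
    \<open>Suc n\<close> on unchanged. The slack e is shared equally between this selector and the
    tail.\<close>
  define w where "w = w'(n := v)"
  have w: "w \<in> controls"
    unfolding w_def by (rule controls_update[OF w' v])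
  obtain C where C: "\<And>n w x. n \<le> N \<Longrightarrow> w \<in> controls \<Longrightarrow> x \<in> D \<Longrightarrow> \<bar>J w n x\<bar> \<le> C"
    using expected_reward_bounded by blast
  have J_eq: "J w (Suc n) = J w' (Suc n)"
    using step by (intro ext expected_reward_cong) (auto simp: w_def)
  have "AE x in \<mu>. V n x - e \<le> J w n x"
    using v_opt AE_space
  proof eventually_elim
    case (elim x)
    then have x: "x \<in> D"
      by (simp add: space_mu)
    have vx: "v x \<in> DU"
      using control_in[OF w step(2) x] by (simp add: w_def)
    have "V n x \<le> f n x (v x) + NE (V (Suc n)) n x (v x) + e / 2"
      unfolding value_fn_def[of P \<xi> N D DU dyn f g n]
    proof (rule cSUP_least[OF controls_nonempty])
      fix a
      assume a: "a \<in> controls"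
      have u: "a n x \<in> DU"
        using control_in[OF a step(2) x] .
      show "J a n x \<le> f n x (v x) + NE (V (Suc n)) n x (v x) + e / 2"
        using elim u expected_reward_le_step[OF step(2) a x] by force
    qed
    moreover have "NE (V (Suc n)) n x (v x) - e / 2 \<le> NE (J w (Suc n)) n x (v x)"
      by (rule next_expectation_ge[OF step(2) x vx V_meas[OF n1] Gamma[OF n1]
            expected_reward_measurable[OF w n1] C[OF n1 w]]) (simp_all add: J_eq opt)
    moreover have "J w n x = f n x (v x) + NE (J w (Suc n)) n x (v x)"
      using expected_reward_step[OF step(2) w x] by (simp add: w_def)
    ultimately show ?case
      by simp
  qed
  then show ?case
    using w by blast
qed


lemma bellman_bdd_above:
  assumes n: "n < N" and x: "x \<in> D"
  shows "bdd_above ((\<lambda>u. f n x u + NE (V (Suc n)) n x u) ` DU)"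
proof -
  obtain C where C: "\<And>s x u. s < N \<Longrightarrow> x \<in> D \<Longrightarrow> u \<in> DU \<Longrightarrow> \<bar>f s x u\<bar> \<le> C"
    using f_bound by blast
  have "f n x u + NE (V (Suc n)) n x u \<le> C + \<Gamma>" if "u \<in> DU" for u
    using C[OF n x that] abs_next_expectation_le[OF n x that V_meas[of "Suc n"], of \<Gamma>] n Gamma
    by fastforce
  then show ?thesis
    by (rule bdd_aboveI2)
qed

text \<open>For the lower bound, any fixed \<open>u\<close> is played at time \<open>n\<close> as a
  constant control and followed by a tail policy that is nearly optimal almost everywhere. The
  equation still holds at every state, since only the next state meets the exceptional set, with
  probability 0.\<close>

lemma bellman_equation:
  assumes n: "n < N" and x: "x \<in> D"
  shows "V n x = (SUP u\<in>DU. f n x u + NE (V (Suc n)) n x u)"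
proof (rule antisym)
  have "J w n x \<le> (SUP u\<in>DU. f n x u + NE (V (Suc n)) n x u)" if w: "w \<in> controls" for w
    using control_in[OF w n x] bellman_bdd_above[OF n x]
    by (intro order.trans[OF expected_reward_le_step[OF n w x]] cSUP_upper)
  then show "V n x \<le> (SUP u\<in>DU. f n x u + NE (V (Suc n)) n x u)"
    unfolding value_fn_def[of P \<xi> N D DU dyn f g n]
    by (intro cSUP_least controls_nonempty)
  show "(SUP u\<in>DU. f n x u + NE (V (Suc n)) n x u) \<le> V n x"
  proof (rule cSUP_least[OF DU_nonempty], rule field_le_epsilon)
    fix u and e :: real
    assume u: "u \<in> DU" and "0 < e"
    then obtain w' where w': "w' \<in> controls" and opt: "AE x in \<mu>. V (Suc n) x - e \<le> J w' (Suc n) x"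
      using near_optimal_control[of "Suc n" e] n by auto
    note n1 = Suc_leI[OF n]
    define w where "w = w'(n := (\<lambda>_. u))"
    have w: "w \<in> controls"
      unfolding w_def by (rule controls_update[OF w' const_control[OF u]])
    obtain C where C: "\<And>n w x. n \<le> N \<Longrightarrow> w \<in> controls \<Longrightarrow> x \<in> D \<Longrightarrow> \<bar>J w n x\<bar> \<le> C"
      using expected_reward_bounded by blast
    have J_eq: "J w (Suc n) = J w' (Suc n)"
      using n by (intro ext expected_reward_cong) (auto simp: w_def)
    have "NE (V (Suc n)) n x u - e \<le> NE (J w (Suc n)) n x u"
      by (rule next_expectation_ge[OF n x u V_meas[OF n1] Gamma[OF n1]
            expected_reward_measurable[OF w n1] C[OF n1 w]]) (simp_all add: J_eq opt)
    then show "f n x u + NE (V (Suc n)) n x u \<le> V n x + e"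
      using expected_reward_step[OF n w x] expected_reward_le_value[OF w less_imp_le[OF n] x]
      by (simp add: w_def)
  qed
qed

text \<open>Jensen's inequality and \<open>r \<le> R\<^sup>2\<close>.\<close>

lemma abs_next_expectation_le_l2:
  assumes n: "n < N" and x: "x \<in> D" and u: "u \<in> DU"
    and h: "h \<in> borel_measurable \<mu>" "integrable \<mu> (\<lambda>y. (h y)\<^sup>2)"
  shows "\<bar>NE h n x u\<bar> \<le> R * l2_norm \<mu> h"
    and "integrable P (\<lambda>\<omega>. h (dyn n x (\<xi> n \<omega>) u))"
proof -
  note d = r_density[OF n x u]
  have r: "0 \<le> r n x u y" "r n x u y \<le> R\<^sup>2" if "y \<in> space \<mu>" for y
    using r_bound[OF n x u] that by (auto simp: space_mu)
  note r_meas = distributed_real_measurable[OF r(1) d]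
  have rh: "r n x u y * (h y)\<^sup>2 \<le> R\<^sup>2 * (h y)\<^sup>2" if "y \<in> space \<mu>" for y
    using r(2)[OF that] by (intro mult_right_mono) auto
  have Rh: "integrable \<mu> (\<lambda>y. R\<^sup>2 * (h y)\<^sup>2)"
    using h(2) by simp
  have int: "integrable \<mu> (\<lambda>y. r n x u y * (h y)\<^sup>2)"
    using h(1) r_meas r rh by (intro Bochner_Integration.integrable_bound[OF Rh]) auto
  have X: "(\<lambda>\<omega>. dyn n x (\<xi> n \<omega>) u) \<in> P \<rightarrow>\<^sub>M \<mu>"
    using d by (rule distributed_measurable)
  have sq: "integrable P (\<lambda>\<omega>. (h (dyn n x (\<xi> n \<omega>) u))\<^sup>2)"
    using int distributed_integrable[OF d, of "\<lambda>y. (h y)\<^sup>2"] h(1) r by simp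
  then show "integrable P (\<lambda>\<omega>. h (dyn n x (\<xi> n \<omega>) u))"
    by (rule square_integrable_imp_integrable[OF measurable_compose[OF X h(1)]])
  have "(NE h n x u)\<^sup>2 \<le> (\<integral>\<omega>. (h (dyn n x (\<xi> n \<omega>) u))\<^sup>2 \<partial>P)"
    unfolding next_expectation_def
    by (rule expectation_square_le[OF measurable_compose[OF X h(1)] sq])
  also have "\<dots> = (\<integral>y. r n x u y * (h y)\<^sup>2 \<partial>\<mu>)"
    using distributed_integral[OF d, of "\<lambda>y. (h y)\<^sup>2"] h(1) r by simp
  also have "\<dots> \<le> (\<integral>y. R\<^sup>2 * (h y)\<^sup>2 \<partial>\<mu>)"
    using int Rh rh by (rule integral_mono)
  also have "\<dots> = (R * l2_norm \<mu> h)\<^sup>2"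
    by (simp add: power_mult_distrib l2_norm_power2)
  finally have "\<bar>NE h n x u\<bar>\<^sup>2 \<le> (R * l2_norm \<mu> h)\<^sup>2"
    by simp
  then show "\<bar>NE h n x u\<bar> \<le> R * l2_norm \<mu> h"
    by (rule power2_le_imp_le) (use R_pos in simp)
qed

end

section \<open>Error of the value iteration\<close>

lemma abs_cSUP_diff_le:
  fixes F G :: "'a \<Rightarrow> real"
  assumes "A \<noteq> {}" and F: "bdd_above (F ` A)" and G: "bdd_above (G ` A)"
    and le: "\<And>u. u \<in> A \<Longrightarrow> \<bar>F u - G u\<bar> \<le> d"
  shows "\<bar>(SUP u\<in>A. F u) - (SUP u\<in>A. G u)\<bar> \<le> d"
proof -
  have "(SUP u\<in>A. F u) \<le> (SUP u\<in>A. G u) + d"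
  proof (rule cSUP_least[OF \<open>A \<noteq> {}\<close>])
    fix u
    assume "u \<in> A"
    then show "F u \<le> (SUP u\<in>A. G u) + d"
      using le[of u] cSUP_upper[OF _ G, of u] by linarith
  qed
  moreover have "(SUP u\<in>A. G u) \<le> (SUP u\<in>A. F u) + d"
  proof (rule cSUP_least[OF \<open>A \<noteq> {}\<close>])
    fix u
    assume "u \<in> A"
    then show "G u \<le> (SUP u\<in>A. F u) + d"
      using le[of u] cSUP_upper[OF _ F, of u] by linarith
  qed
  ultimately show ?thesis
    by linarith
qed

lemma borel_measurable_vec_lambda:
  fixes h :: "'k::finite \<Rightarrow> 'a \<Rightarrow> real"
  assumes "\<And>k. h k \<in> borel_measurable M"
  shows "(\<lambda>x. \<chi> k. h k x) \<in> borel_measurable M"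
  using assms by (subst borel_measurable_euclidean_space) (auto simp: Basis_vec_def inner_axis)

section \<open>The random estimate: dependence on the training points and measurability\<close>

locale value_iteration =
  controlled_density N D DU P \<xi> dyn f g \<mu> r R \<Gamma> + l2_basis \<mu> \<phi>
  for N :: nat and D :: "(real^'d) set" and DU :: "(real^'q) set"
    and P :: "'w measure" and \<xi> :: "nat \<Rightarrow> 'w \<Rightarrow> real"
    and dyn :: "nat \<Rightarrow> real^'d \<Rightarrow> real \<Rightarrow> real^'q \<Rightarrow> real^'d"
    and f :: "nat \<Rightarrow> real^'d \<Rightarrow> real^'q \<Rightarrow> real" and g :: "real^'d \<Rightarrow> real"
    and \<mu> :: "(real^'d) measure" and r :: "nat \<Rightarrow> real^'d \<Rightarrow> real^'q \<Rightarrow> real^'d \<Rightarrow> real"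
    and R \<Gamma> :: real and \<phi> :: "'k::finite \<Rightarrow> real^'d \<Rightarrow> real" +
  fixes M :: nat
  assumes M_pos: "1 \<le> M"
    and sup_meas: "\<And>s \<alpha>. s < N \<Longrightarrow>
        control_sup DU f (\<lambda>n k. NE (\<phi> k) n) s \<alpha> \<in> borel_measurable (restrict_space borel D)"
begin

abbreviation "csup \<equiv> control_sup DU f (\<lambda>n k. NE (\<phi> k) n)"
abbreviation "vh \<equiv> vhat_back N M \<mu> DU f g \<Gamma> \<phi> (\<lambda>n k. NE (\<phi> k) n)"

definition sample_idx :: "nat \<Rightarrow> (nat \<times> nat) set" where
  "sample_idx j = {1..M} \<times> {N - j + 1..N}"

text \<open>The points for time N - j, at which \<open>vh j\<close> is sampled to produce
  \<open>vh (Suc j)\<close>. \<open>sample_idx j\<close> stops just short of them, so they are fresh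
  for \<open>vh j\<close>.\<close>

definition step_idx :: "nat \<Rightarrow> (nat \<times> nat) set" where
  "step_idx j = {1..M} \<times> {N - j}"

definition step_coeff :: "nat \<Rightarrow> (nat \<times> nat \<Rightarrow> real^'d) \<Rightarrow> real^'k" where
  "step_coeff j p = matrix_inv (gram \<mu> \<phi>) *v sample_moments (step_idx j) (vh j p) p"

lemma idx_Suc:
  assumes "j < N"
  shows "sample_idx (Suc j) = sample_idx j \<union> step_idx j" "sample_idx j \<inter> step_idx j = {}"
  using assms by (auto simp: sample_idx_def step_idx_def)

lemma finite_idx [simp]: "finite (sample_idx j)" "finite (step_idx j)"
  by (simp_all add: sample_idx_def step_idx_def)

lemma step_idx_nonempty: "step_idx j \<noteq> {}"
  using M_pos by (auto simp: step_idx_def)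

lemma card_step_idx: "card (step_idx j) = M"
  by (simp add: step_idx_def card_cartesian_product)

lemma vh_Suc:
  assumes "j < N"
  shows "vh (Suc j) p x = max (- \<Gamma>) (min \<Gamma> (csup (N - Suc j) (step_coeff j p) x))"
proof -
  have reindex: "(\<Sum>i\<in>step_idx j. h (p i)) = (\<Sum>m=1..M. h (p (m, N - j)))" for h :: "real^'d \<Rightarrow> real"
    unfolding step_idx_def
    by (rule sum.reindex_bij_witness[of _ "\<lambda>m. (m, N - j)" fst]) auto
  have "regression_coeff \<mu> \<phi> M (vh j p) (\<lambda>m. p (m, N - j)) = step_coeff j p"
    unfolding regression_coeff_def step_coeff_def sample_moments_def
    by (intro arg_cong[of _ _ "(*v) _"])
      (simp add: vec_eq_iff card_step_idx reindex[of "\<lambda>x. vh j p x * \<phi> k x" for k])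
  then show ?thesis
    using assms by (simp add: Suc_diff_Suc Let_def)
qed

declare vhat_back.simps(2) [simp del]

lemma Gamma_nonneg: "0 \<le> \<Gamma>"
proof -
  interpret mu: prob_space \<mu> by (fact mu)
  obtain x where "x \<in> D"
    using mu.not_empty space_mu by auto
  then show ?thesis
    using Gamma[of 0 x] by (intro order.trans[OF abs_ge_zero]) auto
qed

lemma vh_bounded:
  assumes "j \<le> N" "x \<in> D"
  shows "\<bar>vh j p x\<bar> \<le> \<Gamma>"
proof (cases j)
  \<comment> \<open>At the horizon nothing is truncated, but g is the value function there and so
    obeys the same bound.\<close>
  case 0
  then show ?thesis
    using Gamma[of N x] assms by (simp add: value_terminal)
next
  case (Suc i)
  then show ?thesis
    using assms Gamma_nonneg by (simp only: vh_Suc Suc_le_lessD)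
qed

lemma vh_cong:
  assumes "\<And>i. i \<in> sample_idx j \<Longrightarrow> p i = q i" "j \<le> N"
  shows "vh j p = vh j q"
  using assms
proof (induction j)
  case (Suc j)
  then have "vh j p = vh j q"
    using idx_Suc[of j] by (intro Suc.IH) auto
  moreover have "p i = q i" if "i \<in> step_idx j" for i
    using Suc.prems idx_Suc[of j] that by auto
  ultimately have "step_coeff j p = step_coeff j q"
    by (simp add: step_coeff_def sample_moments_def cong: sum.cong)
  then show ?case
    using Suc.prems by (simp only: vh_Suc Suc_le_lessD fun_eq_iff) auto
qed simp

lemma next_expectation_comb:
  assumes "n < N" "x \<in> D" "u \<in> DU"
  shows "NE (comb c) n x u = (\<Sum>k\<in>UNIV. c$k * NE (\<phi> k) n x u)"
  unfolding next_expectation_def comb_def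
  using abs_next_expectation_le_l2(2)[OF assms phi_meas phi_L2]
  by (subst Bochner_Integration.integral_sum) auto

lemma csup_eq:
  assumes "n < N" "x \<in> D"
  shows "csup n c x = (SUP u\<in>DU. f n x u + NE (comb c) n x u)"
  unfolding control_sup_def using assms by (intro SUP_cong refl) (simp add: next_expectation_comb)

lemma csup_bdd_above:
  assumes n: "n < N" and x: "x \<in> D"
  shows "bdd_above ((\<lambda>u. f n x u + NE (comb c) n x u) ` DU)"
proof -
  obtain C where C: "\<And>s x u. s < N \<Longrightarrow> x \<in> D \<Longrightarrow> u \<in> DU \<Longrightarrow> \<bar>f s x u\<bar> \<le> C"
    using f_bound by blast
  have "f n x u + NE (comb c) n x u \<le> C + R * l2_norm \<mu> (comb c)" if "u \<in> DU" for u
    using C[OF n x that] abs_next_expectation_le_l2(1)[OF n x that comb_measurable comb_L2, of c]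
    by linarith
  then show ?thesis
    by (rule bdd_aboveI2)
qed

text \<open>R comes from the one-step expectation, and the root of the Gram norm from bounding the
  L2 norm of \<open>comb c\<close> by the Euclidean norm of \<open>c\<close>.\<close>

lemma csup_lipschitz:
  assumes n: "n < N" and x: "x \<in> D"
  shows "\<bar>csup n a x - csup n b x\<bar> \<le> R * sqrt (onorm ((*v) (gram \<mu> \<phi>))) * dist a b"
  unfolding csup_eq[OF assms]
proof (rule abs_cSUP_diff_le[OF DU_nonempty csup_bdd_above[OF assms] csup_bdd_above[OF assms]])
  fix u
  assume u: "u \<in> DU"
  let ?A = "gram \<mu> \<phi>"
  define c where "c = a - b"
  have "(l2_norm \<mu> (comb c))\<^sup>2 \<le> norm c * norm (?A *v c)"
    unfolding l2_norm_comb by (rule norm_cauchy_schwarz)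
  also have "\<dots> \<le> norm c * (onorm ((*v) ?A) * norm c)"
    by (intro mult_left_mono onorm matrix_vector_mul_bounded_linear) simp
  also have "\<dots> = (sqrt (onorm ((*v) ?A)) * norm c)\<^sup>2"
    using onorm_pos_le[OF matrix_vector_mul_bounded_linear, of ?A]
    by (simp add: power_mult_distrib power2_eq_square)
  finally have "l2_norm \<mu> (comb c) \<le> sqrt (onorm ((*v) ?A)) * norm c"
    by (rule power2_le_imp_le)
      (use onorm_pos_le[OF matrix_vector_mul_bounded_linear, of ?A] in simp)
  then have "R * l2_norm \<mu> (comb c) \<le> R * sqrt (onorm ((*v) ?A)) * dist a b"
    using R_pos by (simp add: dist_norm c_def mult.assoc)
  moreover have "\<bar>NE (comb c) n x u\<bar> \<le> R * l2_norm \<mu> (comb c)"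
    by (rule abs_next_expectation_le_l2(1)[OF n x u comb_measurable comb_L2])
  moreover have "NE (comb c) n x u = NE (comb a) n x u - NE (comb b) n x u"
    using assms u by (simp add: next_expectation_comb c_def left_diff_distrib sum_subtractf)
  ultimately show "\<bar>f n x u + NE (comb a) n x u - (f n x u + NE (comb b) n x u)\<bar>
      \<le> R * sqrt (onorm ((*v) ?A)) * dist a b"
    by simp
qed

text \<open>Joint measurability is what permits inserting coefficients that depend on the training
  points.\<close>

lemma csup_measurable:
  assumes n: "n < N"
  shows "(\<lambda>(a, x). csup n a x) \<in> borel_measurable (borel \<Otimes>\<^sub>M \<mu>)"
proof (rule borel_measurable_lipschitz_parameter)
  show "csup n a \<in> borel_measurable \<mu>" for a
    using sup_meas[OF n] by (simp add: measurable_mu)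
qed (use csup_lipschitz[OF n] in \<open>simp add: space_mu\<close>)

lemma vh_measurable:
  assumes "j \<le> N" "sample_idx j \<subseteq> I"
  shows "(\<lambda>(p, x). vh j p x) \<in> borel_measurable ((\<Pi>\<^sub>M i\<in>I. \<mu>) \<Otimes>\<^sub>M \<mu>)"
    and "j < N \<Longrightarrow> step_idx j \<subseteq> I \<Longrightarrow> step_coeff j \<in> borel_measurable (\<Pi>\<^sub>M i\<in>I. \<mu>)"
proof -
  \<comment> \<open>The two claims feed each other: the coefficients need the estimate at level
    \<open>j\<close>, and the estimate at \<open>Suc j\<close> needs the coefficients. Hence this
    half is first proved relative to the other.\<close>
  have coeff: "step_coeff j \<in> borel_measurable (\<Pi>\<^sub>M i\<in>I. \<mu>)"
    if j: "j < N" "step_idx j \<subseteq> I"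
      and vh: "(\<lambda>(p, x). vh j p x) \<in> borel_measurable ((\<Pi>\<^sub>M i\<in>I. \<mu>) \<Otimes>\<^sub>M \<mu>)" for j
  proof -
    have pi: "(\<lambda>p. p i) \<in> (\<Pi>\<^sub>M i\<in>I. \<mu>) \<rightarrow>\<^sub>M \<mu>" if "i \<in> step_idx j" for i
      using that j by (intro measurable_component_singleton) auto
    have "(\<lambda>p. vh j p (p i)) \<in> borel_measurable (\<Pi>\<^sub>M i\<in>I. \<mu>)" if "i \<in> step_idx j" for i
      using measurable_compose[OF measurable_Pair[OF measurable_ident_sets[OF refl] pi[OF that]] vh]
      by simp
    then have "(\<lambda>p. sample_moments (step_idx j) (vh j p) p) \<in> borel_measurable (\<Pi>\<^sub>M i\<in>I. \<mu>)"
      unfolding sample_moments_def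
      by (intro borel_measurable_vec_lambda borel_measurable_divide borel_measurable_sum
          borel_measurable_times measurable_compose[OF pi phi_meas] borel_measurable_const)
    then show ?thesis
      unfolding step_coeff_def
      by (rule measurable_compose)
        (intro borel_measurable_continuous_onI linear_continuous_on matrix_vector_mul_bounded_linear)
  qed
  show vh: "(\<lambda>(p, x). vh j p x) \<in> borel_measurable ((\<Pi>\<^sub>M i\<in>I. \<mu>) \<Otimes>\<^sub>M \<mu>)"
    using assms
  proof (induction j)
    case 0
    have "g \<in> borel_measurable \<mu>"
      using g_meas by (simp add: measurable_mu)
    then show ?case
      by (simp add: split_def)
  next
    case (Suc j)
    then have j: "j < N" "sample_idx j \<subseteq> I" "step_idx j \<subseteq> I"
      using idx_Suc[of j] by auto
    have "step_coeff j \<in> borel_measurable (\<Pi>\<^sub>M i\<in>I. \<mu>)"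
      using j Suc.IH by (intro coeff) auto
    then have "(\<lambda>q. (step_coeff j (fst q), snd q)) \<in> (\<Pi>\<^sub>M i\<in>I. \<mu>) \<Otimes>\<^sub>M \<mu> \<rightarrow>\<^sub>M borel \<Otimes>\<^sub>M \<mu>"
      by (intro measurable_Pair measurable_compose[OF measurable_fst] measurable_snd)
    from measurable_compose[OF this csup_measurable, of "N - Suc j"] j
    have "(\<lambda>q. csup (N - Suc j) (step_coeff j (fst q)) (snd q))
        \<in> borel_measurable ((\<Pi>\<^sub>M i\<in>I. \<mu>) \<Otimes>\<^sub>M \<mu>)"
      by simp
    then have "(\<lambda>q. vh (Suc j) (fst q) (snd q)) \<in> borel_measurable ((\<Pi>\<^sub>M i\<in>I. \<mu>) \<Otimes>\<^sub>M \<mu>)"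
      unfolding vh_Suc[OF j(1)]
      by (intro borel_measurable_max borel_measurable_min borel_measurable_const)
    then show ?case
      by (simp only: split_def)
  qed
  show "step_coeff j \<in> borel_measurable (\<Pi>\<^sub>M i\<in>I. \<mu>)" if "j < N" "step_idx j \<subseteq> I"
    using that vh by (rule coeff)
qed


section \<open>Mean-square error recursion\<close>

abbreviation "Q j \<equiv> (\<Pi>\<^sub>M i\<in>sample_idx j. \<mu>)"

text \<open>The error in the state variable alone, with the training points frozen; the norm over
  \<open>p\<close> is taken afterwards.\<close>

definition err :: "nat \<Rightarrow> (nat \<times> nat \<Rightarrow> real^'d) \<Rightarrow> real" where
  "err j p = l2_norm \<mu> (\<lambda>x. vh j p x - V (N - j) x)"

definition proj_err :: real where
  "proj_err = Max ((\<lambda>n. l2_norm \<mu> (\<lambda>x. l2_proj \<mu> \<phi> (V n) x - V n x)) ` {1..N})"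

definition phi_max :: real where
  "phi_max = Max (range (\<lambda>k. l2_norm \<mu> (\<phi> k)))"

definition sample_err :: "nat \<Rightarrow> (nat \<times> nat \<Rightarrow> real^'d) \<Rightarrow> real" where
  "sample_err j p = norm (sample_moments (step_idx j) (vh j p) p - moments (vh j p))"

lemma V_L2:
  assumes "n \<le> N"
  shows "V n \<in> borel_measurable \<mu>" "integrable \<mu> (\<lambda>x. (V n x)\<^sup>2)"
proof -
  interpret mu: prob_space \<mu> by (fact mu)
  show V: "V n \<in> borel_measurable \<mu>"
    using V_meas[OF assms] by (simp add: measurable_mu)
  show "integrable \<mu> (\<lambda>x. (V n x)\<^sup>2)"
    using Gamma[OF assms] by (intro mu.square_integrable_bounded[OF V]) (simp add: space_mu)
qed

lemma vh_L2:
  assumes "j \<le> N" "sample_idx j \<subseteq> I" "p \<in> space (\<Pi>\<^sub>M i\<in>I. \<mu>)"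
  shows "vh j p \<in> borel_measurable \<mu>" "integrable \<mu> (\<lambda>x. (vh j p x)\<^sup>2)"
proof -
  interpret mu: prob_space \<mu> by (fact mu)
  show vh: "vh j p \<in> borel_measurable \<mu>"
    using measurable_compose[OF measurable_Pair1'[OF assms(3)] vh_measurable(1)[OF assms(1,2)]]
    by simp
  show "integrable \<mu> (\<lambda>x. (vh j p x)\<^sup>2)"
    using vh_bounded[OF assms(1)] by (intro mu.square_integrable_bounded[OF vh]) (simp add: space_mu)
qed

text \<open>Both functions come from suprema over the same controls with the same running reward, so
  only the difference of the continuation values matters. The bound does not depend on
  \<open>x\<close>.\<close>

lemma vh_step_error:
  assumes j: "j < N" and x: "x \<in> D"
  shows "\<bar>vh (Suc j) p x - V (N - Suc j) x\<bar>
    \<le> R * l2_norm \<mu> (\<lambda>y. comb (step_coeff j p) y - V (N - j) y)"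
proof -
  define n where "n = N - Suc j"
  have n: "n < N" "Suc n = N - j"
    using j by (auto simp: n_def)
  let ?c = "step_coeff j p"
  note V2 = V_L2[of "Suc n"]
  have diff: "(\<lambda>y. comb ?c y - V (Suc n) y) \<in> borel_measurable \<mu>"
    "integrable \<mu> (\<lambda>y. (comb ?c y - V (Suc n) y)\<^sup>2)"
    using V2 n(1) square_integrable_diff[OF comb_measurable _ comb_L2, of "V (Suc n)"] by auto
  have "\<bar>csup n ?c x - V n x\<bar> \<le> R * l2_norm \<mu> (\<lambda>y. comb ?c y - V (Suc n) y)"
    unfolding csup_eq[OF n(1) x] bellman_equation[OF n(1) x]
  proof (rule abs_cSUP_diff_le[OF DU_nonempty csup_bdd_above[OF n(1) x] bellman_bdd_above[OF n(1) x]])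
    fix u
    assume u: "u \<in> DU"
    have "integrable P (\<lambda>\<omega>. comb ?c (dyn n x (\<xi> n \<omega>) u))" "integrable P (\<lambda>\<omega>. V (Suc n) (dyn n x (\<xi> n \<omega>) u))"
      using abs_next_expectation_le_l2(2)[OF n(1) x u] V2 n(1) comb_L2 by auto
    then have "NE (\<lambda>y. comb ?c y - V (Suc n) y) n x u = NE (comb ?c) n x u - NE (V (Suc n)) n x u"
      by (simp add: next_expectation_def)
    then show "\<bar>f n x u + NE (comb ?c) n x u - (f n x u + NE (V (Suc n)) n x u)\<bar>
        \<le> R * l2_norm \<mu> (\<lambda>y. comb ?c y - V (Suc n) y)"
      using abs_next_expectation_le_l2(1)[OF n(1) x u diff] by simp
  qed
  \<comment> \<open>Clipping to an interval that contains the true value cannot increase the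
    distance to it.\<close>
  moreover have "\<bar>vh (Suc j) p x - V n x\<bar> \<le> \<bar>csup n ?c x - V n x\<bar>"
    using Gamma[of n x] n(1) x unfolding vh_Suc[OF j] n_def[symmetric] by auto
  ultimately show ?thesis
    unfolding n(2)[symmetric] n_def[symmetric] by linarith
qed

lemma err_step:
  assumes j: "j < N" and p: "p \<in> space (Q (Suc j))"
  shows "err (Suc j) p \<le> R * (inv_sqrt_norm * sample_err j p + err j p + proj_err)"
proof -
  interpret mu: prob_space \<mu> by (fact mu)
  let ?E = "l2_norm \<mu> (\<lambda>y. comb (step_coeff j p) y - V (N - j) y)"
  \<comment> \<open>The pointwise bound is constant in the state, and its norm under a probability
    measure is the constant itself.\<close>
  have "err (Suc j) p \<le> l2_norm \<mu> (\<lambda>_. R * ?E)"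
    unfolding err_def using vh_step_error[OF j] R_pos
    by (intro l2_norm_mono AE_I2) (auto simp: space_mu)
  also have "\<dots> = R * ?E"
    using R_pos by (simp add: l2_norm_def mu.prob_space)
  also have "?E \<le> inv_sqrt_norm * sample_err j p + err j p
      + l2_norm \<mu> (\<lambda>y. l2_proj \<mu> \<phi> (V (N - j)) y - V (N - j) y)"
    unfolding step_coeff_def sample_err_def err_def
    using j p idx_Suc(1)[OF j] by (intro regression_error V_L2 vh_L2[of _ "sample_idx (Suc j)"]) auto
  also have "l2_norm \<mu> (\<lambda>y. l2_proj \<mu> \<phi> (V (N - j)) y - V (N - j) y) \<le> proj_err"
    unfolding proj_err_def using j by (intro Max_ge) auto
  finally show ?thesis
    using R_pos by simp
qed

lemma err_measurable:
  assumes "j \<le> N" "sample_idx j \<subseteq> I"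
  shows "err j \<in> borel_measurable (\<Pi>\<^sub>M i\<in>I. \<mu>)"
proof -
  interpret mu: prob_space \<mu> by (fact mu)
  have "(\<lambda>(p, x). (vh j p x - V (N - j) x)\<^sup>2) \<in> borel_measurable ((\<Pi>\<^sub>M i\<in>I. \<mu>) \<Otimes>\<^sub>M \<mu>)"
    using vh_measurable(1)[OF assms] V_L2(1)[of "N - j"] by (simp add: split_def)
  from mu.borel_measurable_lebesgue_integral[OF this] show ?thesis
    unfolding err_def[abs_def] l2_norm_def by simp
qed

lemma err_bounded:
  assumes "j \<le> N"
  shows "0 \<le> err j p" "err j p \<le> 2 * \<Gamma>"
proof -
  interpret mu: prob_space \<mu> by (fact mu)
  have "\<bar>vh j p x - V (N - j) x\<bar> \<le> 2 * \<Gamma>" if "x \<in> D" for x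
    using vh_bounded[OF assms that, of p] Gamma[of "N - j" x] that by force
  then have "err j p \<le> l2_norm \<mu> (\<lambda>_. 2 * \<Gamma>)"
    unfolding err_def using Gamma_nonneg by (intro l2_norm_mono AE_I2) (auto simp: space_mu)
  also have "\<dots> = 2 * \<Gamma>"
    using Gamma_nonneg by (simp add: l2_norm_def mu.prob_space real_sqrt_mult)
  finally show "err j p \<le> 2 * \<Gamma>" .
qed (simp add: err_def)

lemma prob_space_sample: "prob_space (\<Pi>\<^sub>M i\<in>I. \<mu>)"
  using mu(1) by (intro prob_space_PiM)

lemma err_L2:
  assumes "j \<le> N" "sample_idx j \<subseteq> I"
  shows "integrable (\<Pi>\<^sub>M i\<in>I. \<mu>) (\<lambda>p. (err j p)\<^sup>2)"
  using err_bounded[OF assms(1)]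
  by (intro prob_space.square_integrable_bounded[OF prob_space_sample err_measurable[OF assms]]) auto

lemma l2_norm_training_law:
  assumes "j \<le> N"
  shows "l2_norm (training_law N M \<mu> j) (\<lambda>(p, x). vh j p x - V (N - j) x) = l2_norm (Q j) (err j)"
proof -
  interpret mu: prob_space \<mu> by (fact mu)
  interpret Qj: prob_space "Q j" by (rule prob_space_sample)
  interpret Qmu: pair_prob_space "Q j" \<mu> ..
  let ?h = "\<lambda>(p, x). (vh j p x - V (N - j) x)\<^sup>2"
  have "(\<lambda>(p, x). vh j p x - V (N - j) x) \<in> borel_measurable (Q j \<Otimes>\<^sub>M \<mu>)"
    using vh_measurable(1)[OF assms order_refl] V_L2(1)[of "N - j"] by (simp add: split_def)
  moreover have "\<bar>vh j p x - V (N - j) x\<bar> \<le> 2 * \<Gamma>" if "x \<in> D" for p x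
    using vh_bounded[OF assms that, of p] Gamma[of "N - j" x] that by force
  ultimately have "integrable (Q j \<Otimes>\<^sub>M \<mu>) (\<lambda>q. (case q of (p, x) \<Rightarrow> vh j p x - V (N - j) x)\<^sup>2)"
    by (intro Qmu.square_integrable_bounded) (auto simp: space_pair_measure space_mu)
  then have "integrable (Q j \<Otimes>\<^sub>M \<mu>) ?h"
    by (simp add: split_def)
  then have "(\<integral>p. \<integral>x. (vh j p x - V (N - j) x)\<^sup>2 \<partial>\<mu> \<partial>Q j) = integral\<^sup>L (Q j \<Otimes>\<^sub>M \<mu>) ?h"
    using Qmu.integral_fst'[of ?h] by simp
  then show ?thesis
    unfolding l2_norm_def[of "training_law N M \<mu> j"] l2_norm_def[of "Q j"]
    by (simp add: err_def l2_norm_power2 training_law_def sample_idx_def split_def)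
qed

text \<open>\<open>err j\<close> sees only the coordinates in \<open>sample_idx j\<close>, and the
  marginal of a product measure is the smaller product.\<close>

lemma l2_norm_err_Suc:
  assumes j: "j < N"
  shows "l2_norm (Q (Suc j)) (err j) = l2_norm (Q j) (err j)"
proof -
  interpret mu: prob_space \<mu> by (fact mu)
  interpret Q: product_prob_space "\<lambda>_. \<mu>" "sample_idx (Suc j)" ..
  have sub: "sample_idx j \<subseteq> sample_idx (Suc j)"
    using idx_Suc[OF j] by auto
  have "err j (restrict p (sample_idx j)) = err j p" for p
    unfolding err_def using j by (subst vh_cong[of j _ p]) auto
  then have "(\<integral>p. (err j p)\<^sup>2 \<partial>Q (Suc j)) = (\<integral>p. (err j (restrict p (sample_idx j)))\<^sup>2 \<partial>Q (Suc j))"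
    by simp
  also have "\<dots> = (\<integral>p. (err j p)\<^sup>2 \<partial>distr (Q (Suc j)) (Q j) (\<lambda>p. restrict p (sample_idx j)))"
    using j err_measurable[of j "sample_idx j"]
    by (intro integral_distr[symmetric] measurable_restrict_subset sub) auto
  also have "\<dots> = (\<integral>p. (err j p)\<^sup>2 \<partial>Q j)"
    using sub by (subst Q.distr_PiM_restrict_finite) auto
  finally show ?thesis
    by (simp add: l2_norm_def)
qed

lemma sample_err_measurable:
  assumes j: "j < N"
  shows "sample_err j \<in> borel_measurable (Q (Suc j))"
proof -
  interpret mu: prob_space \<mu> by (fact mu)
  note idx = idx_Suc[OF j]
  have pi: "(\<lambda>p. p i) \<in> Q (Suc j) \<rightarrow>\<^sub>M \<mu>" if "i \<in> step_idx j" for i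
    using that idx by (intro measurable_component_singleton) auto
  have vh: "(\<lambda>(p, x). vh j p x) \<in> borel_measurable (Q (Suc j) \<Otimes>\<^sub>M \<mu>)"
    using j idx by (intro vh_measurable(1)) auto
  have "step_coeff j \<in> borel_measurable (Q (Suc j))"
    using j idx by (intro vh_measurable(2)) auto
  \<comment> \<open>Multiplying by the Gram matrix undoes the inverse in \<open>step_coeff\<close>,
    so its known measurability passes to the sample moments.\<close>
  then have "(\<lambda>p. gram \<mu> \<phi> *v step_coeff j p) \<in> borel_measurable (Q (Suc j))"
    by (rule measurable_compose)
      (intro borel_measurable_continuous_onI linear_continuous_on matrix_vector_mul_bounded_linear)
  then have "(\<lambda>p. sample_moments (step_idx j) (vh j p) p) \<in> borel_measurable (Q (Suc j))"
    by (simp add: step_coeff_def gram_inv)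
  moreover have "(\<lambda>(p, x). vh j p x * \<phi> k x) \<in> borel_measurable (Q (Suc j) \<Otimes>\<^sub>M \<mu>)" for k
    using vh by (simp add: split_def)
  then have "(\<lambda>p. moments (vh j p)) \<in> borel_measurable (Q (Suc j))"
    unfolding moments_def
    by (intro borel_measurable_vec_lambda mu.borel_measurable_lebesgue_integral)
  ultimately show ?thesis
    unfolding sample_err_def[abs_def] by simp
qed

text \<open>Given the training points of the later time steps, the estimate \<open>vh j\<close> is fixed, and the
  points of the current step are a fresh sample.\<close>

lemma sample_err_L2:
  assumes j: "j < N"
  shows "integrable (Q (Suc j)) (\<lambda>p. (sample_err j p)\<^sup>2)"
    and "l2_norm (Q (Suc j)) (sample_err j) \<le> sqrt CARD('k) / sqrt M * \<Gamma> * phi_max"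
proof -
  interpret mu: prob_space \<mu> by (fact mu)
  interpret Q: product_sigma_finite "\<lambda>_. \<mu>" ..
  interpret Qj: prob_space "Q j" by (rule prob_space_sample)
  define c where "c = CARD('k) * (\<Gamma> * phi_max)\<^sup>2 / M"
  note idx = idx_Suc[OF j]
  have phi_le: "l2_norm \<mu> (\<phi> k) \<le> phi_max" for k
    unfolding phi_max_def by (intro Max_ge) auto
  have "0 \<le> phi_max"
    by (rule order.trans[OF l2_norm_nonneg phi_le])
  \<comment> \<open>\<open>x\<close> holds the later points and is frozen, which fixes the regressed
    function; \<open>y\<close> is the fresh sample, and the bound is uniform in
    \<open>x\<close>.\<close>
  have inner: "(\<integral>\<^sup>+ y. ennreal ((sample_err j (merge (sample_idx j) (step_idx j) (x, y)))\<^sup>2)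
      \<partial>(\<Pi>\<^sub>M i\<in>step_idx j. \<mu>)) \<le> ennreal c" if x: "x \<in> space (Q j)" for x
  proof -
    define v where "v = vh j x"
    have eq: "sample_err j (merge (sample_idx j) (step_idx j) (x, y))
        = norm (sample_moments (step_idx j) v y - moments v)" for y
    proof -
      have "vh j (merge (sample_idx j) (step_idx j) (x, y)) = v"
        unfolding v_def using j by (intro vh_cong) (auto simp: merge_def)
      moreover have "merge (sample_idx j) (step_idx j) (x, y) i = y i" if "i \<in> step_idx j" for i
        using that idx(2) by (auto simp: merge_def)
      ultimately show ?thesis
        by (simp add: sample_err_def sample_moments_def cong: sum.cong)
    qed
    have v: "v \<in> borel_measurable \<mu>" "\<And>y. y \<in> space \<mu> \<Longrightarrow> \<bar>v y\<bar> \<le> \<Gamma>"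
      using vh_L2(1)[OF _ order_refl x] vh_bounded[of j] j by (auto simp: v_def space_mu)
    note err = sample_moments_error[OF mu(1) finite_idx(2) step_idx_nonempty v phi_le]
    show ?thesis
      unfolding eq using err(2)
      by (subst nn_integral_eq_integral[OF err(1)]) (auto simp: c_def card_step_idx intro: ennreal_leI)
  qed
  have "(\<integral>\<^sup>+ p. ennreal ((sample_err j p)\<^sup>2) \<partial>Q (Suc j))
      = (\<integral>\<^sup>+ x. \<integral>\<^sup>+ y. ennreal ((sample_err j (merge (sample_idx j) (step_idx j) (x, y)))\<^sup>2)
          \<partial>(\<Pi>\<^sub>M i\<in>step_idx j. \<mu>) \<partial>Q j)"
    using sample_err_measurable[OF j] unfolding idx(1)
    by (intro Q.product_nn_integral_fold idx(2)) auto
  also have "\<dots> \<le> (\<integral>\<^sup>+ x. ennreal c \<partial>Q j)"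
    by (intro nn_integral_mono inner)
  also have "\<dots> = ennreal c"
    by (simp add: Qj.emeasure_space_1)
  \<comment> \<open>Working with the nonnegative integral makes integrability a consequence of the
    bound.\<close>
  finally have le: "(\<integral>\<^sup>+ p. ennreal ((sample_err j p)\<^sup>2) \<partial>Q (Suc j)) \<le> ennreal c" .
  show int: "integrable (Q (Suc j)) (\<lambda>p. (sample_err j p)\<^sup>2)"
    using le sample_err_measurable[OF j]
    by (intro integrableI_bounded) (auto intro: le_less_trans)
  have "0 \<le> c"
    by (simp add: c_def)
  have "(\<integral>p. (sample_err j p)\<^sup>2 \<partial>Q (Suc j)) \<le> c"
    using le \<open>0 \<le> c\<close> by (intro integral_real_bounded) auto
  moreover have "c = (sqrt CARD('k) / sqrt M * \<Gamma> * phi_max)\<^sup>2"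
    by (simp add: c_def power_mult_distrib power_divide)
  ultimately show "l2_norm (Q (Suc j)) (sample_err j) \<le> sqrt CARD('k) / sqrt M * \<Gamma> * phi_max"
    using Gamma_nonneg \<open>0 \<le> phi_max\<close> by (subst l2_norm_le_iff) auto
qed

definition step_bound :: real where
  "step_bound = proj_err + sqrt CARD('k) / sqrt M * \<Gamma> * inv_sqrt_norm * phi_max"

text \<open>Minkowski's inequality over the training points, applied to the inequality
  \<open>err_step\<close> that holds for each fixed choice of them.\<close>

lemma l2_norm_err_step:
  assumes j: "j < N"
  shows "l2_norm (Q (Suc j)) (err (Suc j)) \<le> R * (step_bound + l2_norm (Q j) (err j))"
proof -
  interpret Q: prob_space "Q (Suc j)" by (rule prob_space_sample)
  define s where "s p = inv_sqrt_norm * sample_err j p" for p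
  have sub: "sample_idx j \<subseteq> sample_idx (Suc j)"
    using idx_Suc[OF j] by auto
  have meas [measurable]: "s \<in> borel_measurable (Q (Suc j))" "err j \<in> borel_measurable (Q (Suc j))"
    using sample_err_measurable[OF j] err_measurable[OF _ sub] j by (simp_all add: s_def[abs_def])
  have int: "integrable (Q (Suc j)) (\<lambda>p. (s p)\<^sup>2)" "integrable (Q (Suc j)) (\<lambda>p. (err j p)\<^sup>2)"
    using sample_err_L2(1)[OF j] err_L2[OF _ sub] j by (simp_all add: s_def power_mult_distrib)
  note sum_L2 = square_integrable_add[OF meas int]
  \<comment> \<open>Here \<open>j < N\<close> guarantees that the maximum runs over a nonempty
    set.\<close>
  have "0 \<le> proj_err"
    unfolding proj_err_def using j by (subst Max_ge_iff) auto
  have sum3: "(\<lambda>p. s p + err j p + proj_err) \<in> borel_measurable (Q (Suc j))"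
    "integrable (Q (Suc j)) (\<lambda>p. (s p + err j p + proj_err)\<^sup>2)"
    using square_integrable_add[OF _ _ sum_L2, of "\<lambda>_. proj_err"] by auto
  have "l2_norm (Q (Suc j)) (err (Suc j)) \<le> l2_norm (Q (Suc j)) (\<lambda>p. R * (s p + err j p + proj_err))"
  proof (rule l2_norm_mono)
    show "AE p in Q (Suc j). \<bar>err (Suc j) p\<bar> \<le> \<bar>R * (s p + err j p + proj_err)\<bar>"
      using err_step[OF j] err_bounded(1)[of "Suc j"] j by (intro AE_I2) (fastforce simp: s_def)
  qed (use sum3(2) in \<open>simp add: power_mult_distrib\<close>)
  also have "\<dots> = R * l2_norm (Q (Suc j)) (\<lambda>p. s p + err j p + proj_err)"
    using R_pos by (simp add: l2_norm_def power_mult_distrib real_sqrt_mult)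
  also have "l2_norm (Q (Suc j)) (\<lambda>p. s p + err j p + proj_err)
      \<le> l2_norm (Q (Suc j)) (\<lambda>p. s p + err j p) + l2_norm (Q (Suc j)) (\<lambda>_. proj_err)"
    using sum_L2 by (intro l2_norm_triangle) auto
  also have "l2_norm (Q (Suc j)) (\<lambda>_. proj_err) = proj_err"
    using \<open>0 \<le> proj_err\<close> by (simp add: l2_norm_def Q.prob_space)
  also have "l2_norm (Q (Suc j)) (\<lambda>p. s p + err j p)
      \<le> l2_norm (Q (Suc j)) s + l2_norm (Q (Suc j)) (err j)"
    by (rule l2_norm_triangle[OF meas int])
  also have "l2_norm (Q (Suc j)) (err j) = l2_norm (Q j) (err j)"
    by (rule l2_norm_err_Suc[OF j])
  also have "l2_norm (Q (Suc j)) s = inv_sqrt_norm * l2_norm (Q (Suc j)) (sample_err j)"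
    using inv_sqrt_norm_nonneg
    by (simp add: s_def l2_norm_def power_mult_distrib real_sqrt_mult)
  also have "\<dots> \<le> inv_sqrt_norm * (sqrt CARD('k) / sqrt M * \<Gamma> * phi_max)"
    by (intro mult_left_mono sample_err_L2(2)[OF j] inv_sqrt_norm_nonneg)
  finally show ?thesis
    using R_pos by (simp add: step_bound_def algebra_simps)
qed

text \<open>Each backward step adds \<open>step_bound\<close> and multiplies by R, so the powers
  accumulate as in Horner's scheme; at \<open>j = 0\<close> both functions equal g.\<close>

lemma l2_norm_err_le:
  assumes "j \<le> N"
  shows "l2_norm (Q j) (err j) \<le> R * (\<Sum>i<j. R ^ i) * step_bound"
  using assms
proof (induction j)
  case 0
  have "err 0 p = 0" for p
  proof -
    have "(\<integral>x. (g x - V N x)\<^sup>2 \<partial>\<mu>) = (\<integral>x. 0 \<partial>\<mu>)"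
      by (intro Bochner_Integration.integral_cong) (simp_all add: value_terminal)
    then show ?thesis
      by (simp add: err_def l2_norm_def)
  qed
  then show ?case
    by (simp add: l2_norm_def)
next
  case (Suc j)
  have "l2_norm (Q (Suc j)) (err (Suc j)) \<le> R * (step_bound + l2_norm (Q j) (err j))"
    using Suc.prems by (intro l2_norm_err_step) simp
  also have "\<dots> \<le> R * (step_bound + R * (\<Sum>i<j. R ^ i) * step_bound)"
    using Suc R_pos by (intro mult_left_mono add_left_mono) auto
  also have "\<dots> = R * (1 + R * (\<Sum>i<j. R ^ i)) * step_bound"
    by (simp add: algebra_simps)
  also have "1 + R * (\<Sum>i<j. R ^ i) = (\<Sum>i<Suc j. R ^ i)"
    by (simp add: sum.lessThan_Suc_shift sum_distrib_left del: sum.lessThan_Suc)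
  finally show ?case .
qed

end

theorem theorem1:
  fixes N M :: nat
    and D :: "(real^'d) set" and DU :: "(real^'q) set"
    and P :: "'w measure" and \<xi> :: "nat \<Rightarrow> 'w \<Rightarrow> real"
    and dyn :: "nat \<Rightarrow> real^'d \<Rightarrow> real \<Rightarrow> real^'q \<Rightarrow> real^'d"
    and \<mu> :: "(real^'d) measure"
    and r :: "nat \<Rightarrow> real^'d \<Rightarrow> real^'q \<Rightarrow> real^'d \<Rightarrow> real" and R :: real
    and f :: "nat \<Rightarrow> real^'d \<Rightarrow> real^'q \<Rightarrow> real" and g :: "real^'d \<Rightarrow> real"
    and V :: "nat \<Rightarrow> real^'d \<Rightarrow> real" and \<Gamma> :: real
    and \<phi> :: "'k::finite \<Rightarrow> real^'d \<Rightarrow> real"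
    and \<phi>h :: "nat \<Rightarrow> 'k \<Rightarrow> real^'d \<Rightarrow> real^'q \<Rightarrow> real"
    and Vh :: "nat \<Rightarrow> (nat \<times> nat \<Rightarrow> real^'d) \<Rightarrow> real^'d \<Rightarrow> real"
    and \<epsilon>\<^sub>K :: real and n :: nat
  defines "V \<equiv> value_fn P \<xi> N D DU dyn f g"
    and "\<phi>h \<equiv> (\<lambda>n k. next_expectation P \<xi> dyn (\<phi> k) n)"
    and "Vh \<equiv> vhat N M \<mu> DU f g \<Gamma> \<phi> \<phi>h"
    and "\<epsilon>\<^sub>K \<equiv> Max ((\<lambda>n. l2_norm \<mu> (\<lambda>x. l2_proj \<mu> \<phi> (V n) x - V n x)) ` {1..N})"
  assumes "1 \<le> N" and "1 \<le> M"
    and D: "D \<in> sets borel"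
    and DU: "compact DU" "DU \<noteq> {}"
    and P: "prob_space P"
    and xi_indep: "prob_space.indep_vars P (\<lambda>_. borel) \<xi> {..<N}"
    and xi_unif: "\<And>s. s < N \<Longrightarrow> distr P borel (\<xi> s) = uniform_measure lborel {0..1}"
    and xi_range: "\<And>s \<omega>. s < N \<Longrightarrow> \<omega> \<in> space P \<Longrightarrow> \<xi> s \<omega> \<in> {0..1}"
    and dyn: "\<And>s. s < N \<Longrightarrow> (\<lambda>(x, z, u). dyn s x z u)
        \<in> restrict_space borel D \<Otimes>\<^sub>M restrict_space borel {0..1} \<Otimes>\<^sub>M restrict_space borel DU
          \<rightarrow>\<^sub>M restrict_space borel D"
    and mu: "prob_space \<mu>" "sets \<mu> = sets (restrict_space borel D)"
    and r_meas: "\<And>s. s < N \<Longrightarrow> (\<lambda>(x, u, y). r s x u y)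
        \<in> borel_measurable (restrict_space borel D \<Otimes>\<^sub>M restrict_space borel DU \<Otimes>\<^sub>M \<mu>)"
    and r_density: "\<And>s x u. s < N \<Longrightarrow> x \<in> D \<Longrightarrow> u \<in> DU
        \<Longrightarrow> distributed P \<mu> (\<lambda>\<omega>. dyn s x (\<xi> s \<omega>) u) (\<lambda>y. ennreal (r s x u y))"
    and "0 < R"
    and r_bound: "\<And>s x u y. s < N \<Longrightarrow> x \<in> D \<Longrightarrow> u \<in> DU \<Longrightarrow> y \<in> D
        \<Longrightarrow> 0 \<le> r s x u y \<and> r s x u y \<le> R\<^sup>2"
    and f_meas: "\<And>s. s < N \<Longrightarrow> (\<lambda>(x, u). f s x u)
        \<in> borel_measurable (restrict_space borel D \<Otimes>\<^sub>M restrict_space borel DU)"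
    and f_bounded: "\<And>s. s < N \<Longrightarrow> bounded ((\<lambda>(x, u). f s x u) ` (D \<times> DU))"
    and g_meas: "g \<in> borel_measurable (restrict_space borel D)"
    and g_bounded: "bounded (g ` D)"
    and Gamma: "\<And>s x. s \<le> N \<Longrightarrow> x \<in> D \<Longrightarrow> \<bar>V s x\<bar> \<le> \<Gamma>"
    and phi_meas: "\<And>k. \<phi> k \<in> borel_measurable \<mu>"
    and phi_L2: "\<And>k. integrable \<mu> (\<lambda>x. (\<phi> k x)\<^sup>2)"
    and phi_indep: "l2_independent \<mu> \<phi>"
    and f_usc: "\<And>s x. s < N \<Longrightarrow> x \<in> D \<Longrightarrow> upper_semicontinuous_on DU (f s x)"
    and phih_usc: "\<And>s k x. s < N \<Longrightarrow> x \<in> D \<Longrightarrow> upper_semicontinuous_on DU (\<phi>h s k x)"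
    \<comment> \<open>functions of the state obtained by optimising over the control are measurable: the value
      function, its (near-)maximisers, and the supremum in the value iteration\<close>
    and V_meas: "\<And>s. s \<le> N \<Longrightarrow> V s \<in> borel_measurable (restrict_space borel D)"
    and V_select: "\<And>s e. s < N \<Longrightarrow> 0 < e \<Longrightarrow>
        \<exists>w \<in> restrict_space borel D \<rightarrow>\<^sub>M restrict_space borel DU. AE x in \<mu>. \<forall>u\<in>DU.
          f s x u + next_expectation P \<xi> dyn (V (Suc s)) s x u
            \<le> f s x (w x) + next_expectation P \<xi> dyn (V (Suc s)) s x (w x) + e"
    and sup_meas: "\<And>s \<alpha>. s < N \<Longrightarrow>
        control_sup DU f \<phi>h s \<alpha> \<in> borel_measurable (restrict_space borel D)"
    and "n \<le> N"
  shows "l2_norm (training_law N M \<mu> (N - n)) (\<lambda>(p, x). Vh n p x - V n x)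
      \<le> R * (if R = 1 then real (N - n) else (R ^ (N - n) - 1) / (R - 1))
        * (\<epsilon>\<^sub>K + sqrt (real CARD('k)) / sqrt (real M) * \<Gamma>
            * onorm ((*v) (matrix_inv (matrix_sqrt (gram \<mu> \<phi>))))
            * Max (range (\<lambda>k. l2_norm \<mu> (\<phi> k))))"
proof -
  have "value_iteration N D DU P \<xi> dyn f g \<mu> r R \<Gamma> \<phi> M"
    using assms(5-) unfolding V_def \<phi>h_def
    by (intro value_iteration.intro controlled_density.intro controlled_process.intro
        controlled_process_axioms.intro controlled_density_axioms.intro l2_basis.intro
        value_iteration_axioms.intro) auto
  then interpret value_iteration N D DU P \<xi> dyn f g \<mu> r R \<Gamma> \<phi> M .
  have geometric: "(\<Sum>i<N - n. R ^ i)
      = (if R = 1 then real (N - n) else (R ^ (N - n) - 1) / (R - 1))"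
    by (simp add: geometric_sum)
  have "l2_norm (training_law N M \<mu> (N - n)) (\<lambda>(p, x). Vh n p x - V n x)
      = l2_norm (\<Pi>\<^sub>M i\<in>sample_idx (N - n). \<mu>) (err (N - n))"
    using l2_norm_training_law[of "N - n"] \<open>n \<le> N\<close>
    by (simp add: Vh_def V_def \<phi>h_def vhat_def)
  also have "\<dots> \<le> R * (\<Sum>i<N - n. R ^ i) * step_bound"
    by (rule l2_norm_err_le) simp
  finally show ?thesis
    unfolding geometric step_bound_def proj_err_def phi_max_def inv_sqrt_norm_def
    unfolding \<epsilon>\<^sub>K_def V_def .
qed

end
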